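(* For the Range Subgraph Listing problem with pattern $Q=$ $\ell$-star (for a constant $\ell$), there is a data structure of $O(m)$ space answering a query with an $\tilde{O}(1)$ delay.
   Context: Range Subgraph Listing: $G=(V,E)$ is an undirected graph with $m=|E|$ edges, each vertex $v$ carrying a real-valued attribute $A_v$. For an interval $q=[x_1,x_2]$, $G_q$ is the subgraph of $G$ induced by $\{v\in V\mid x_1\le A_v\le x_2\}$. A query, given $q$, reports all occurrences (subgraphs isomorphic to $Q$) of $Q$ in $G_q$. An $\ell$-star is a tree with $\ell$ leaves and exactly one non-leaf vertex. A query has delay $\Delta$ if, after the previous output (with a dummy output assumed at the start), it reports a new occurrence or declares that there are no more occurrences within $\Delta$ time. $\tilde{O}(\cdot)$ hides polylogarithmic factors. *)

theory Defs
  imports Complex_Main "HOL-Library.Landau_Symbols"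
begin

section \<open>Finite simple undirected graphs\<close>

type_synonym 'a ugraph = "'a set \<times> 'a set set"

abbreviation verts :: "'a ugraph \<Rightarrow> 'a set" where "verts \<equiv> fst"
abbreviation edges :: "'a ugraph \<Rightarrow> 'a set set" where "edges \<equiv> snd"

definition simple_graph :: "'a ugraph \<Rightarrow> bool" where
  "simple_graph G \<longleftrightarrow>
     finite (verts G) \<and> (\<forall>e\<in>edges G. e \<subseteq> verts G \<and> card e = 2)"

definition subgraph :: "'a ugraph \<Rightarrow> 'a ugraph \<Rightarrow> bool" where
  "subgraph H G \<longleftrightarrow> simple_graph H \<and> verts H \<subseteq> verts G \<and> edges H \<subseteq> edges G"

definition induced :: "'a ugraph \<Rightarrow> 'a set \<Rightarrow> 'a ugraph" where
  "induced G U = (verts G \<inter> U, {e\<in>edges G. e \<subseteq> U})"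

definition isomorphic :: "'a ugraph \<Rightarrow> 'b ugraph \<Rightarrow> bool" where
  "isomorphic G H \<longleftrightarrow> (\<exists>f. bij_betw f (verts G) (verts H) \<and>
     (\<forall>u\<in>verts G. \<forall>v\<in>verts G. {u, v} \<in> edges G \<longleftrightarrow> {f u, f v} \<in> edges H))"

definition connected_graph :: "'a ugraph \<Rightarrow> bool" where
  "connected_graph G \<longleftrightarrow> verts G \<noteq> {} \<and>
     (\<forall>u\<in>verts G. \<forall>v\<in>verts G. (\<lambda>a b. {a, b} \<in> edges G)\<^sup>*\<^sup>* u v)"

definition is_cycle :: "'a ugraph \<Rightarrow> 'a list \<Rightarrow> bool" where
  "is_cycle G p \<longleftrightarrow> length p \<ge> 3 \<and> distinct p \<and>
     (\<forall>i<length p. {p ! i, p ! (Suc i mod length p)} \<in> edges G)"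

definition tree :: "'a ugraph \<Rightarrow> bool" where
  "tree G \<longleftrightarrow> simple_graph G \<and> connected_graph G \<and> (\<not> (\<exists>p. is_cycle G p))"

definition degree :: "'a ugraph \<Rightarrow> 'a \<Rightarrow> nat" where
  "degree G v = card {e\<in>edges G. v \<in> e}"

definition leaf :: "'a ugraph \<Rightarrow> 'a \<Rightarrow> bool" where
  "leaf G v \<longleftrightarrow> v \<in> verts G \<and> degree G v = 1"

definition star :: "nat \<Rightarrow> 'a ugraph \<Rightarrow> bool" where
  "star l Q \<longleftrightarrow> tree Q \<and> card {v. leaf Q v} = l \<and> (\<exists>!v. v \<in> verts Q \<and> \<not> leaf Q v)"


section \<open>Range subgraphs and occurrences\<close>

definition range_subgraph :: "'a ugraph \<Rightarrow> ('a \<Rightarrow> real) \<Rightarrow> real \<Rightarrow> real \<Rightarrow> 'a ugraph" where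
  "range_subgraph G A x1 x2 = induced G {v\<in>verts G. x1 \<le> A v \<and> A v \<le> x2}"

definition occurrences :: "'b ugraph \<Rightarrow> 'a ugraph \<Rightarrow> 'a ugraph set" where
  "occurrences Q G = {H. subgraph H G \<and> isomorphic H Q}"


section \<open>Word RAM with comparable real-valued attributes\<close>

text \<open>
  A memory cell holds either a word, which is a natural number below \<open>2 ^ w\<close>, or a real. Words
  admit the usual arithmetic and bitwise operations; reals are atomic and can only be moved and
  compared. Every instruction takes one unit of time. \<open>Emit\<close> appends a word to an output buffer,
  \<open>Report\<close> outputs the contents of the buffer and clears it, and \<open>Halt\<close> declares that there is no
  further output. In \<open>instr\<close>, registers are addressed by number, and word registers and real
  registers form two separate banks.
\<close>

datatype cell = Word nat | Attr real

datatype wop = Add | Sub | Mul | Div | Mod | And | Or | Xor | Shl | Shr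

datatype instr =
    Const nat nat              (* word register, constant *)
  | Calc wop nat nat nat       (* target, first and second operand: word registers *)
  | MoveA nat nat              (* target, source: real registers *)
  | Load nat nat               (* target word register, word register holding the address *)
  | LoadA nat nat              (* target real register, word register holding the address *)
  | Store nat nat              (* word register holding the address, source word register *)
  | StoreA nat nat             (* word register holding the address, source real register *)
  | Jump nat
  | JumpLess nat nat nat       (* two word registers, jump target *)
  | JumpLessA nat nat nat      (* two real registers, jump target *)
  | Emit nat                   (* word register *)
  | Report
  | Halt

record config =
  pc :: nat
  wreg :: "nat \<Rightarrow> nat"
  areg :: "nat \<Rightarrow> real"
  mem :: "cell list"
  buf :: "nat list"

datatype event = Tick | Output "nat list" | Finished

fun eval_wop :: "nat \<Rightarrow> wop \<Rightarrow> nat \<Rightarrow> nat \<Rightarrow> nat" where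
  "eval_wop w Add x y = take_bit w (x + y)"
| "eval_wop w Sub x y = take_bit w (2 ^ w + x - y)"
| "eval_wop w Mul x y = take_bit w (x * y)"
| "eval_wop w Div x y = take_bit w (x div y)"
| "eval_wop w Mod x y = take_bit w (x mod y)"
| "eval_wop w And x y = take_bit w (and x y)"
| "eval_wop w Or x y = take_bit w (or x y)"
| "eval_wop w Xor x y = take_bit w (xor x y)"
| "eval_wop w Shl x y = take_bit w (push_bit y x)"
| "eval_wop w Shr x y = take_bit w (drop_bit y x)"

text \<open>
  The first \<open>d\<close> cells are read-only. The result \<open>None\<close> is a fault: an access outside the memory,
  a load of the wrong kind of cell, a write to a read-only cell, or a program counter outside the
  program.
\<close>

fun exec :: "nat \<Rightarrow> nat \<Rightarrow> instr \<Rightarrow> config \<Rightarrow> (event \<times> config) option" where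
  "exec w d (Const r c) s = Some (Tick, s\<lparr>wreg := (wreg s)(r := take_bit w c)\<rparr>)"
| "exec w d (Calc f r a b) s =
     Some (Tick, s\<lparr>wreg := (wreg s)(r := eval_wop w f (wreg s a) (wreg s b))\<rparr>)"
| "exec w d (MoveA r a) s = Some (Tick, s\<lparr>areg := (areg s)(r := areg s a)\<rparr>)"
| "exec w d (Load r a) s =
     (if wreg s a < length (mem s) then
        (case mem s ! wreg s a of
           Word x \<Rightarrow> Some (Tick, s\<lparr>wreg := (wreg s)(r := x)\<rparr>)
         | Attr _ \<Rightarrow> None)
      else None)"
| "exec w d (LoadA r a) s =
     (if wreg s a < length (mem s) then
        (case mem s ! wreg s a of
           Word _ \<Rightarrow> None
         | Attr x \<Rightarrow> Some (Tick, s\<lparr>areg := (areg s)(r := x)\<rparr>))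
      else None)"
| "exec w d (Store a r) s =
     (if d \<le> wreg s a \<and> wreg s a < length (mem s)
      then Some (Tick, s\<lparr>mem := (mem s)[wreg s a := Word (wreg s r)]\<rparr>) else None)"
| "exec w d (StoreA a r) s =
     (if d \<le> wreg s a \<and> wreg s a < length (mem s)
      then Some (Tick, s\<lparr>mem := (mem s)[wreg s a := Attr (areg s r)]\<rparr>) else None)"
| "exec w d (Jump l) s = Some (Tick, s\<lparr>pc := l\<rparr>)"
| "exec w d (JumpLess a b l) s =
     Some (Tick, if wreg s a < wreg s b then s\<lparr>pc := l\<rparr> else s)"
| "exec w d (JumpLessA a b l) s =
     Some (Tick, if areg s a < areg s b then s\<lparr>pc := l\<rparr> else s)"
| "exec w d (Emit r) s = Some (Tick, s\<lparr>buf := buf s @ [wreg s r]\<rparr>)"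
| "exec w d Report s = Some (Output (buf s), s\<lparr>buf := []\<rparr>)"
| "exec w d Halt s = Some (Finished, s)"

definition step :: "nat \<Rightarrow> nat \<Rightarrow> instr list \<Rightarrow> config \<Rightarrow> (event \<times> config) option" where
  "step w d P s =
     (if pc s < length P then exec w d (P ! pc s) (s\<lparr>pc := Suc (pc s)\<rparr>) else None)"

definition tick :: "nat \<Rightarrow> nat \<Rightarrow> instr list \<Rightarrow> config \<Rightarrow> config \<Rightarrow> bool" where
  "tick w d P s s' \<longleftrightarrow> step w d P s = Some (Tick, s')"

text \<open>
  \<open>enumerates w d P \<Delta> s out\<close>: the run from \<open>s\<close> outputs exactly the list \<open>out\<close> and then halts, and
  the first output, each further output and the final \<open>Halt\<close> all happen within time \<open>\<Delta>\<close> after the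
  preceding output (the start of the run counting as a dummy output).
\<close>

inductive enumerates ::
  "nat \<Rightarrow> nat \<Rightarrow> instr list \<Rightarrow> real \<Rightarrow> config \<Rightarrow> nat list list \<Rightarrow> bool"
  for w d P \<Delta>
where
  finish: "(tick w d P ^^ n) s s' \<Longrightarrow> step w d P s' = Some (Finished, s'') \<Longrightarrow>
     real (n + 1) \<le> \<Delta> \<Longrightarrow> enumerates w d P \<Delta> s []"
| report: "(tick w d P ^^ n) s s' \<Longrightarrow> step w d P s' = Some (Output x, s'') \<Longrightarrow>
     real (n + 1) \<le> \<Delta> \<Longrightarrow> enumerates w d P \<Delta> s'' xs \<Longrightarrow> enumerates w d P \<Delta> s (x # xs)"

text \<open>The two endpoints of the query interval are passed in the first two real registers.\<close>

definition query_config :: "real \<Rightarrow> real \<Rightarrow> cell list \<Rightarrow> config" where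
  "query_config x1 x2 M =
     \<lparr>pc = 0, wreg = (\<lambda>_. 0), areg = (\<lambda>i. if i = 0 then x1 else x2), mem = M, buf = []\<rparr>"


section \<open>Data structures for Range Subgraph Listing\<close>

text \<open>
  An occurrence of a pattern \<open>Q\<close> with vertices \<open>0, \<dots>, k - 1\<close> is output as the list of the
  vertices that play the roles of \<open>0, \<dots>, k - 1\<close>; \<open>decode Q xs\<close> is the subgraph so described.
  Different lists may describe the same subgraph.
\<close>

definition decode :: "nat ugraph \<Rightarrow> nat list \<Rightarrow> nat ugraph" where
  "decode Q xs = ((\<lambda>i. xs ! i) ` verts Q, (\<lambda>e. (\<lambda>i. xs ! i) ` e) ` edges Q)"

definition lists_occurrences :: "nat ugraph \<Rightarrow> nat ugraph \<Rightarrow> nat list list \<Rightarrow> bool" where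
  "lists_occurrences Q G out \<longleftrightarrow>
     (\<forall>xs\<in>set out. length xs = card (verts Q)) \<and>
     distinct (map (decode Q) out) \<and>
     set (map (decode Q) out) = occurrences Q G"

definition word_cells :: "nat \<Rightarrow> cell list \<Rightarrow> bool" where
  "word_cells w M \<longleftrightarrow> (\<forall>x. Word x \<in> set M \<longrightarrow> x < 2 ^ w)"

text \<open>
  The structure stored for \<open>G\<close> consists of the read-only cells \<open>D\<close>, whose reals are attribute
  values, and of \<open>k\<close> cells of working memory whose contents at the start of a query are arbitrary
  (for instance left over from previous queries). Both parts count towards the space. The query
  program \<open>P\<close> does not depend on \<open>G\<close>, on the attributes or on the word length \<open>w\<close>.  The word
  length is only required to be at least logarithmic, \<open>w \<ge> c log (m + 2)\<close> for a constant \<open>c\<close>,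
  and large enough for a vertex identifier to fit into a word.
\<close>

definition solves_range_listing ::
  "nat ugraph \<Rightarrow> instr list \<Rightarrow> real \<Rightarrow> (nat \<Rightarrow> real) \<Rightarrow> (nat \<Rightarrow> real) \<Rightarrow> bool" where
  "solves_range_listing Q P c space delay \<longleftrightarrow>
     (\<forall>(G :: nat ugraph) (A :: nat \<Rightarrow> real) (w :: nat).
        simple_graph G \<and> verts G \<subseteq> {..<2 ^ w} \<and>
        c * log 2 (real (card (edges G)) + 2) \<le> real w \<longrightarrow>
        (\<exists>D k. word_cells w D \<and>
           (\<forall>x. Attr x \<in> set D \<longrightarrow> x \<in> A ` verts G) \<and>
           real (length D + k) \<le> space (card (edges G)) \<and>
           (\<forall>x1 x2 W. length W = k \<and> word_cells w W \<longrightarrow>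
              (\<exists>out. enumerates w (length D) P (delay (card (edges G)))
                       (query_config x1 x2 (D @ W)) out \<and>
                     lists_occurrences Q (range_subgraph G A x1 x2) out))))"

definition soft_O :: "(nat \<Rightarrow> real) \<Rightarrow> (nat \<Rightarrow> real) set" where
  "soft_O g = (\<Union>k::nat. O(\<lambda>n. g n * ln (real n) ^ k))"

end

theory Submission
  imports Defs "HOL-Real_Asymp.Real_Asymp"
begin

text \<open>
  Sort every adjacency list by attribute. The \<open>l\<close>-stars with centre \<open>v\<close> are grouped by their leaf
  \<open>u\<^sub>i\<close> that comes first in the list of \<open>v\<close>. Such a group has a star inside the query interval iff it
  has one with the leaves \<open>u\<^sub>i, \<dots>, u\<^bsub>i+l-1\<^esub>\<close>, that is, iff the interval contains both
  \<open>lo = min (A v) (A u\<^sub>i)\<close> and \<open>hi = max (A v) (A u\<^bsub>i+l-1\<^esub>)\<close>. So the query has to report the at most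
  \<open>2 m\<close> points \<open>(lo, hi)\<close> with \<open>x1 \<le> lo\<close> and \<open>hi \<le> x2\<close>, and each reported point yields at least one
  star. The points are the leaves, by decreasing \<open>lo\<close>, of a balanced tree whose nodes store
  the minimal \<open>hi\<close> below them: a traversal in preorder skips the subtrees without a point
  \<open>hi \<le> x2\<close> and halts at the first remaining point with \<open>lo < x1\<close>. Within a group, the remaining
  \<open>l - 1\<close> leaves run through the increasing subsequences of a segment of the adjacency list, and
  looking ahead for the room that is still needed prevents fruitless descents.
\<close>

section \<open>Equal blocks in a concatenation; runs and time limits\<close>

lemma nth_concat_uniform:
  assumes "\<And>x. x \<in> set xs \<Longrightarrow> length (f x) = n" "i < length xs" "t < n"
  shows "concat (map f xs) ! (n * i + t) = f (xs ! i) ! t"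
  using assms
proof (induction xs arbitrary: i)
  case (Cons x xs)
  show ?case
  proof (cases i)
    case 0
    with Cons.prems show ?thesis by (simp add: nth_append)
  next
    case (Suc i')
    have "concat (map f xs) ! (n * i' + t) = f (xs ! i') ! t"
      using Cons.prems Suc by (intro Cons.IH) auto
    with Cons.prems Suc show ?thesis by (simp add: nth_append)
  qed
qed simp

lemma length_concat_uniform:
  assumes "\<And>x. x \<in> set xs \<Longrightarrow> length (f x) = n"
  shows "length (concat (map f xs)) = n * length xs"
  using assms by (induction xs) auto

text \<open>A functional form of \<open>tick w d P ^^ n\<close>, so that the simplifier can execute
  a stretch of the program symbolically.\<close>

primrec run :: "nat \<Rightarrow> nat \<Rightarrow> instr list \<Rightarrow> nat \<Rightarrow> config \<Rightarrow> config option" where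
  "run w d P 0 s = Some s"
| "run w d P (Suc n) s =
     (case step w d P s of Some (Tick, s') \<Rightarrow> run w d P n s' | _ \<Rightarrow> None)"

lemma run_numeral:
  "run w d P (numeral n) s =
     (case step w d P s of Some (Tick, s') \<Rightarrow> run w d P (pred_numeral n) s' | _ \<Rightarrow> None)"
  by (simp add: numeral_eq_Suc)

lemma run_relpow: "run w d P n s = Some s' \<Longrightarrow> (tick w d P ^^ n) s s'"
proof (induction n arbitrary: s)
  case (Suc n)
  then obtain s1 where "step w d P s = Some (Tick, s1)" "run w d P n s1 = Some s'"
    by (auto split: option.splits prod.splits event.splits)
  moreover from this have "tick w d P s s1" by (simp add: tick_def)
  ultimately show ?case by (metis Suc.IH relpowp_Suc_I2)
qed simp

lemma run_add:
  "run w d P m s = Some s' \<Longrightarrow> run w d P n s' = Some s'' \<Longrightarrow> run w d P (m + n) s = Some s''"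
  by (induction m arbitrary: s) (auto split: option.splits prod.splits event.splits)

text \<open>In \<open>enum_within\<close> only the first event has its own time limit \<open>n\<close>; all later ones have the
  limit \<open>\<Delta>\<close>. This makes the time bound of a run compositional.\<close>

definition enum_within ::
  "nat \<Rightarrow> nat \<Rightarrow> instr list \<Rightarrow> real \<Rightarrow> nat \<Rightarrow> config \<Rightarrow> nat list list \<Rightarrow> bool" where
  "enum_within w d P \<Delta> n s out \<longleftrightarrow> (\<exists>k s'. (tick w d P ^^ k) s s' \<and> k < n \<and>
     ((out = [] \<and> (\<exists>s''. step w d P s' = Some (Finished, s''))) \<or>
      (\<exists>x s'' xs. step w d P s' = Some (Output x, s'') \<and> out = x # xs \<and>
         enumerates w d P \<Delta> s'' xs)))"

lemma enum_within_enumerates: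
  assumes "enum_within w d P \<Delta> n s out" "real n \<le> \<Delta>"
  shows "enumerates w d P \<Delta> s out"
proof -
  obtain k s' where k: "(tick w d P ^^ k) s s'" "k < n" and
    e: "(out = [] \<and> (\<exists>s''. step w d P s' = Some (Finished, s''))) \<or>
      (\<exists>x s'' xs. step w d P s' = Some (Output x, s'') \<and> out = x # xs \<and>
         enumerates w d P \<Delta> s'' xs)"
    using assms(1) unfolding enum_within_def by blast
  have "real (k + 1) \<le> \<Delta>" using k(2) assms(2) by linarith
  with k(1) e show ?thesis by (auto intro: enumerates.intros)
qed

lemma enum_within_mono: "enum_within w d P \<Delta> n s out \<Longrightarrow> n \<le> n' \<Longrightarrow> enum_within w d P \<Delta> n' s out"
  unfolding enum_within_def by (elim exE conjE, intro exI conjI) (assumption, simp, assumption)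

lemma enum_within_run:
  assumes "run w d P a s = Some s'" "enum_within w d P \<Delta> n s' out" "a + n \<le> n'"
  shows "enum_within w d P \<Delta> n' s out"
proof -
  from assms(2) obtain k s1 where k: "(tick w d P ^^ k) s' s1" "k < n" and
    e: "(out = [] \<and> (\<exists>s''. step w d P s1 = Some (Finished, s''))) \<or>
      (\<exists>x s'' xs. step w d P s1 = Some (Output x, s'') \<and> out = x # xs \<and>
         enumerates w d P \<Delta> s'' xs)"
    unfolding enum_within_def by blast
  have "(tick w d P ^^ (a + k)) s s1"
    using run_relpow[OF assms(1)] k(1) by (auto simp: relpowp_add)
  moreover have "a + k < n'" using k(2) assms(3) by simp
  ultimately show ?thesis using e unfolding enum_within_def by blast
qed

lemma enum_within_halt:
  "step w d P s = Some (Finished, s') \<Longrightarrow> 0 < n \<Longrightarrow> enum_within w d P \<Delta> n s []"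
  unfolding enum_within_def by (intro exI[of _ 0] exI[of _ s]) auto

text \<open>A report restarts the clock: \<open>n\<close> has to cover only this event, while the
  limit \<open>m\<close> for the rest must respect \<open>\<Delta>\<close>.\<close>

lemma enum_within_report:
  assumes "step w d P s = Some (Output x, s')" "enum_within w d P \<Delta> m s' xs" "real m \<le> \<Delta>" "0 < n"
  shows "enum_within w d P \<Delta> n s (x # xs)"
  unfolding enum_within_def
  using assms(1,4) enum_within_enumerates[OF assms(2,3)]
  by (intro exI[of _ 0] exI[of _ s]) auto


section \<open>The query program\<close>

text \<open>Registers \<open>0, \<dots>, l\<close> hold the addresses of the records of the vertices playing the roles
  \<open>0, \<dots>, l\<close>; register \<open>c\<close>, for the centre, doubles as the pointer into the search tree.\<close>

definition leaf_reg :: "nat \<Rightarrow> nat \<Rightarrow> nat" where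
  "leaf_reg c j = (if j < c then j else Suc j)"

text \<open>Entry points: 1 moves to the next record in preorder, 3 examines the record at
  \<open>c\<close>, 8 halts, 19 jumps over a subtree, 21 treats a leaf of the tree. A record with
  skip address \<open>0\<close> leads to \<open>Halt\<close>. Words have no move instruction, so
  \<open>Calc Or\<close> with equal operands copies a register.\<close>

definition main_code :: "nat \<Rightarrow> nat \<Rightarrow> instr list" where
  "main_code l c = (let t = l + 1; e = l + 2; sk = l + 3; q = leaf_reg c 0 in
     [Jump 3,
      Const t 6, Calc Add c c t,
      Const t 3, Calc Add t t c, Load sk t, Const t 0, JumpLess t sk 9,
      Halt,
      Const t 1, Calc Add t t c, LoadA 2 t, JumpLessA 1 2 19,
      Const t 4, Calc Add t t c, Load q t, Const t 0, JumpLess t q 21, Jump 1,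
      Calc Or c sk sk, Jump 3,
      Const t 2, Calc Add t t c, LoadA 2 t, JumpLessA 2 0 8,
      Const t 5, Calc Add t t c, Load e t, Calc Or (leaf_reg c 1) q q])"

text \<open>Levels follow the 29 main instructions in blocks of 9. Level \<open>0\<close> is the
  tree traversal, resumed at the next record once level \<open>1\<close> is exhausted; level
  \<open>l\<close> is the output code.\<close>

definition level_pc :: "nat \<Rightarrow> nat" where
  "level_pc j = (if j = 0 then 1 else 20 + 9 * j)"

text \<open>Level \<open>j\<close> moves the \<open>j\<close>-th leaf to the next neighbour of the centre. It goes on only if the
  remaining \<open>l - 1 - j\<close> leaves still fit behind it, so every descent ends in an output. The offset
  \<open>1\<close> addresses the attribute cell of a record; it does not disturb the comparison with the
  end of the adjacency list, as all record addresses are multiples of \<open>6\<close>.\<close>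

definition level_code :: "nat \<Rightarrow> nat \<Rightarrow> nat \<Rightarrow> instr list" where
  "level_code l c j = (let t = l + 1; e = l + 2; q = leaf_reg c j in
     [Const t 6, Calc Add q q t,
      Const t (6 * (l - 1 - j) + 1), Calc Add t t q, JumpLess t e (level_pc j + 6),
      Jump (level_pc (j - 1)),
      LoadA 2 t, JumpLessA 1 2 (level_pc (j - 1)),
      Calc Or (leaf_reg c (Suc j)) q q])"

definition emit_code :: "nat \<Rightarrow> nat \<Rightarrow> instr list" where
  "emit_code l i = [Load (l + 1) i, Emit (l + 1)]"

definition query_prog :: "nat \<Rightarrow> nat \<Rightarrow> instr list" where
  "query_prog l c = main_code l c @ concat (map (level_code l c) [1..<l]) @
     concat (map (emit_code l) [0..<Suc l]) @ [Report, Jump (level_pc (l - 1))]"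

lemma length_main_code: "length (main_code l c) = 29"
  by (simp add: main_code_def Let_def)

lemma length_level_code: "length (level_code l c j) = 9"
  by (simp add: level_code_def Let_def)

lemma length_emit_code: "length (emit_code l i) = 2"
  by (simp add: emit_code_def)

lemma length_levels: "length (concat (map (level_code l c) [1..<l])) = 9 * (l - 1)"
  by (subst length_concat_uniform[where n = 9]) (auto simp: length_level_code)

lemma length_emits: "length (concat (map (emit_code l) [0..<Suc l])) = 2 * Suc l"
  by (subst length_concat_uniform[where n = 2]) (auto simp: length_emit_code)

lemma length_query_prog: "2 \<le> l \<Longrightarrow> length (query_prog l c) = 24 + 11 * l"
  unfolding query_prog_def length_append length_main_code length_levels length_emits by simp

lemma query_prog_main: "i < 29 \<Longrightarrow> query_prog l c ! i = main_code l c ! i"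
  by (simp add: query_prog_def nth_append length_main_code)

lemma query_prog_level:
  assumes "1 \<le> j" "j < l" "t < 9"
  shows "query_prog l c ! (20 + 9 * j + t) = level_code l c j ! t"
proof -
  obtain j' where j: "j = Suc j'" using assms(1) by (cases j) auto
  have "concat (map (level_code l c) [1..<l]) ! (9 * j' + t) = level_code l c ([1..<l] ! j') ! t"
    using assms j by (intro nth_concat_uniform) (auto simp: length_level_code)
  moreover have "9 * j' + t < 9 * (l - 1)" using assms j by auto
  moreover have "20 + 9 * j + t = 29 + (9 * j' + t)" by (simp add: j)
  ultimately show ?thesis
    using assms j
    unfolding query_prog_def nth_append length_main_code length_levels by (simp add: nth_append)
qed

lemma query_prog_emit:
  assumes "2 \<le> l" "i \<le> l" "t < 2"
  shows "query_prog l c ! (20 + 9 * l + (2 * i + t)) = emit_code l i ! t"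
proof -
  have "concat (map (emit_code l) [0..<Suc l]) ! (2 * i + t) = emit_code l ([0..<Suc l] ! i) ! t"
    using assms by (intro nth_concat_uniform) (auto simp: length_emit_code simp del: upt_Suc)
  moreover have "2 * i + t < 2 * Suc l" using assms by auto
  moreover have "\<not> 20 + 9 * l + (2 * i + t) < 29" "\<not> 20 + 9 * l + (2 * i + t) - 29 < 9 * (l - 1)"
    "20 + 9 * l + (2 * i + t) - 29 - 9 * (l - 1) = 2 * i + t"
    using assms by auto
  ultimately show ?thesis
    using assms
    unfolding query_prog_def nth_append length_main_code length_levels length_emits
    by (simp del: upt_Suc)
qed

lemma query_prog_report:
  assumes "2 \<le> l"
  shows "query_prog l c ! (22 + 11 * l) = Report"
    and "query_prog l c ! (23 + 11 * l) = Jump (level_pc (l - 1))"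
proof -
  have 1: "\<not> 22 + 11 * l < 29" "\<not> 22 + 11 * l - 29 < 9 * (l - 1)"
    "\<not> 22 + 11 * l - 29 - 9 * (l - 1) < 2 * Suc l"
    "22 + 11 * l - 29 - 9 * (l - 1) - 2 * Suc l = 0" using assms by auto
  show "query_prog l c ! (22 + 11 * l) = Report"
    unfolding query_prog_def nth_append length_main_code length_levels length_emits
    using 1 by (simp del: upt_Suc)
  have 2: "\<not> 23 + 11 * l < 29" "\<not> 23 + 11 * l - 29 < 9 * (l - 1)"
    "\<not> 23 + 11 * l - 29 - 9 * (l - 1) < 2 * Suc l"
    "23 + 11 * l - 29 - 9 * (l - 1) - 2 * Suc l = 1" using assms by auto
  show "query_prog l c ! (23 + 11 * l) = Jump (level_pc (l - 1))"
    unfolding query_prog_def nth_append length_main_code length_levels length_emits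
    using 2 by (simp del: upt_Suc)
qed

text \<open>The order is that of the backtracking program: first the lists starting with
  \<open>x\<close>, then the later ones. The guard is its look-ahead: an increasing list of length
  \<open>Suc r\<close> from \<open>x\<close> on fits below \<open>f\<close> iff
  \<open>x + r < f\<close>.\<close>

function subseqs_between :: "nat \<Rightarrow> nat \<Rightarrow> nat \<Rightarrow> nat list list" where
  "subseqs_between 0 x f = [[]]"
| "subseqs_between (Suc r) x f =
     (if x + r < f then map ((#) x) (subseqs_between r (Suc x) f) @ subseqs_between (Suc r) (Suc x) f
      else [])"
  by pat_completeness auto
termination by (relation "measure (\<lambda>(r, x, f). r + (f - x))") auto

declare subseqs_between.simps(2) [simp del]

lemma set_subseqs_between:
  "set (subseqs_between r x f) = {q. length q = r \<and> sorted_wrt (<) q \<and> set q \<subseteq> {x..<f}}"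
proof (induction r x f rule: subseqs_between.induct)
  case (2 r x f)
  show ?case
  proof (cases "x + r < f")
    case True
    have "q \<in> set (subseqs_between (Suc r) x f) \<longleftrightarrow>
       length q = Suc r \<and> sorted_wrt (<) q \<and> set q \<subseteq> {x..<f}" for q
    proof (cases q)
      case (Cons y q')
      show ?thesis
      proof (cases "y = x")
        case True
        have "subseqs_between (Suc r) x f =
          map ((#) x) (subseqs_between r (Suc x) f) @ subseqs_between (Suc r) (Suc x) f"
          using \<open>x + r < f\<close> by (simp add: subseqs_between.simps(2)[of r x])
        with 2 \<open>x + r < f\<close> Cons True show ?thesis by (auto simp: Suc_le_eq subset_iff image_iff)
      next
        case False
        \<comment> \<open>As the head \<open>y\<close> differs from \<open>x\<close>, the lower
          bounds \<open>x\<close> and \<open>Suc x\<close> admit the same lists.\<close>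
        have "(\<forall>z\<in>set q'. y < z \<and> x \<le> z \<and> z < f) \<and> x \<le> y \<longleftrightarrow>
          (\<forall>z\<in>set q'. y < z \<and> Suc x \<le> z \<and> z < f) \<and> Suc x \<le> y"
          using False by force
        moreover have "subseqs_between (Suc r) x f =
          map ((#) x) (subseqs_between r (Suc x) f) @ subseqs_between (Suc r) (Suc x) f"
          using \<open>x + r < f\<close> by (simp add: subseqs_between.simps(2)[of r x])
        ultimately show ?thesis using False 2 \<open>x + r < f\<close> Cons by (auto simp: subset_iff)
      qed
    qed (use 2 True in \<open>auto simp: subseqs_between.simps(2)[of r x]\<close>)
    then show ?thesis by blast
  next
    case False
    have "\<not> (length q = Suc r \<and> sorted_wrt (<) q \<and> set q \<subseteq> {x..<f})" for q
    proof
      assume q: "length q = Suc r \<and> sorted_wrt (<) q \<and> set q \<subseteq> {x..<f}"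
      \<comment> \<open>Entries of a strictly increasing list are distinct, and an interval of at
        most \<open>r\<close> numbers cannot hold \<open>Suc r\<close> of them.\<close>
      then have "card (set q) = Suc r" by (metis strict_sorted_iff distinct_card)
      moreover have "card (set q) \<le> f - x" using q by (metis card_mono card_atLeastLessThan finite_atLeastLessThan)
      ultimately show False using False by simp
    qed
    then show ?thesis using False by (auto simp: subseqs_between.simps(2)[of r x])
  qed
qed auto

lemma distinct_subseqs_between: "distinct (subseqs_between r x f)"
proof (induction r x f rule: subseqs_between.induct)
  case (2 r x f)
  have "set (map ((#) x) (subseqs_between r (Suc x) f)) \<inter> set (subseqs_between (Suc r) (Suc x) f) = {}"
    by (subst set_subseqs_between) auto
  with 2 show ?case by (auto simp: distinct_map subseqs_between.simps(2)[of r x])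
qed auto

section \<open>Behaviour of the query program on a list of records\<close>

lemma leaf_reg_neq [simp]: "leaf_reg c j \<noteq> c" "c \<noteq> leaf_reg c j"
  by (auto simp: leaf_reg_def)

lemma leaf_reg_eq_iff [simp]: "leaf_reg c i = leaf_reg c j \<longleftrightarrow> i = j"
  by (auto simp: leaf_reg_def)

lemma leaf_reg_le: "j < l \<Longrightarrow> leaf_reg c j \<le> l"
  by (auto simp: leaf_reg_def)

text \<open>The entries of \<open>ps\<close> are record positions of the leaves. The index
  \<open>r - 1\<close> behind the centre undoes the gap that \<open>leaf_reg\<close> leaves at role
  \<open>c\<close>.\<close>

definition star_listing :: "nat \<Rightarrow> nat \<Rightarrow> (nat \<Rightarrow> nat) \<Rightarrow> nat \<Rightarrow> nat list \<Rightarrow> nat list" where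
  "star_listing l c ident v ps =
     map (\<lambda>r. if r = c then v else ident (ps ! (if r < c then r else r - 1))) [0..<Suc l]"

text \<open>Addresses are six times record positions. The look-ahead may point past the data by
  fewer than \<open>l\<close> records, and the bound on \<open>2 ^ w\<close> keeps even such
  addresses from wrapping around.\<close>

locale query_machine =
  fixes w l c :: nat and recs :: "cell list list" and x1 x2 \<Delta> :: real
    and ident :: "nat \<Rightarrow> nat" and attr :: "nat \<Rightarrow> real"
  assumes l_ge_2: "2 \<le> l" and c_le_l: "c \<le> l"
    and length_rec: "\<And>r. r \<in> set recs \<Longrightarrow> length r = 6"
    and addresses_fit: "6 * (length recs + l + 1) < 2 ^ w"
begin

abbreviation listing where "listing \<equiv> star_listing l c ident"
abbreviation prog where "prog \<equiv> query_prog l c"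
abbreviation data where "data \<equiv> concat recs"
abbreviation exec_for where "exec_for \<equiv> run w (length data) prog"
abbreviation enum where "enum \<equiv> enum_within w (length data) prog \<Delta>"

text \<open>The invariant outside the output code: the program writes no real register but number 2,
  never stores to memory, and fills the buffer only just before a report.\<close>

definition quiet :: "config \<Rightarrow> bool" where
  "quiet s \<longleftrightarrow> areg s 0 = x1 \<and> areg s (Suc 0) = x2 \<and> mem s = data \<and> buf s = []"

lemma length_data: "length data = 6 * length recs"
  using length_concat_uniform[of recs id 6] length_rec by simp

lemma data_nth: "i < length recs \<Longrightarrow> t < 6 \<Longrightarrow> data ! (6 * i + t) = recs ! i ! t"
  using nth_concat_uniform[of recs id 6 i t] length_rec by simp

lemma data_nths:
  assumes "i < length recs"
  shows "data ! (6 * i) = recs ! i ! 0" "data ! Suc (6 * i) = recs ! i ! 1"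
    "data ! (2 + 6 * i) = recs ! i ! 2" "data ! (3 + 6 * i) = recs ! i ! 3"
    "data ! (4 + 6 * i) = recs ! i ! 4" "data ! (5 + 6 * i) = recs ! i ! 5"
    "data ! Suc (Suc (6 * i)) = recs ! i ! 2"
  using data_nth[OF assms, of 0] data_nth[OF assms, of 1] data_nth[OF assms, of 2]
    data_nth[OF assms, of 3] data_nth[OF assms, of 4] data_nth[OF assms, of 5]
  by (simp_all add: add.commute)

lemma take_bit_addr: "x < 6 * (length recs + l + 1) \<Longrightarrow> take_bit w x = x"
  using addresses_fit by (simp add: take_bit_nat_eq_self)

lemma take_bit_small:
  "take_bit w 0 = (0::nat)" "take_bit w (Suc 0) = Suc 0" "take_bit w 2 = (2::nat)"
  "take_bit w 3 = (3::nat)" "take_bit w 4 = (4::nat)" "take_bit w 5 = (5::nat)"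
  "take_bit w 6 = (6::nat)" "w \<noteq> 0" "2 \<le> w"
proof -
  show "2 \<le> w"
  proof (rule ccontr)
    assume "\<not> 2 \<le> w"
    then have "(2::nat) ^ w \<le> 2 ^ 1" by (intro power_increasing) auto
    with addresses_fit show False by simp
  qed
  then show "w \<noteq> 0" "take_bit w 0 = (0::nat)" "take_bit w (Suc 0) = Suc 0" "take_bit w 2 = (2::nat)"
    by auto
qed (use l_ge_2 in \<open>auto intro!: take_bit_addr\<close>)

lemma prog_length: "length prog = 24 + 11 * l"
  by (rule length_query_prog[OF l_ge_2])

lemma main_instrs:
  "prog ! 0 = Jump 3"
  "prog ! Suc 0 = Const (l + 1) 6"
  "prog ! Suc (Suc 0) = Calc Add c c (l + 1)"
  "prog ! 3 = Const (l + 1) 3"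
  "prog ! 4 = Calc Add (l + 1) (l + 1) c"
  "prog ! 5 = Load (l + 3) (l + 1)"
  "prog ! 6 = Const (l + 1) 0"
  "prog ! 7 = JumpLess (l + 1) (l + 3) 9"
  "prog ! 8 = Halt"
  "prog ! 9 = Const (l + 1) 1"
  "prog ! 10 = Calc Add (l + 1) (l + 1) c"
  "prog ! 11 = LoadA 2 (l + 1)"
  "prog ! 12 = JumpLessA 1 2 19"
  "prog ! 13 = Const (l + 1) 4"
  "prog ! 14 = Calc Add (l + 1) (l + 1) c"
  "prog ! 15 = Load (leaf_reg c 0) (l + 1)"
  "prog ! 16 = Const (l + 1) 0"
  "prog ! 17 = JumpLess (l + 1) (leaf_reg c 0) 21"
  "prog ! 18 = Jump 1"
  "prog ! 19 = Calc Or c (l + 3) (l + 3)"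
  "prog ! 20 = Jump 3"
  "prog ! 21 = Const (l + 1) 2"
  "prog ! 22 = Calc Add (l + 1) (l + 1) c"
  "prog ! 23 = LoadA 2 (l + 1)"
  "prog ! 24 = JumpLessA 2 0 8"
  "prog ! 25 = Const (l + 1) 5"
  "prog ! 26 = Calc Add (l + 1) (l + 1) c"
  "prog ! 27 = Load (l + 2) (l + 1)"
  "prog ! 28 = Calc Or (leaf_reg c 1) (leaf_reg c 0) (leaf_reg c 0)"
  by (simp_all add: query_prog_main main_code_def Let_def)

lemma regs_distinct:
  "c \<noteq> Suc l" "c \<noteq> Suc (Suc l)" "c \<noteq> l + 3" "Suc l \<noteq> c" "Suc (Suc l) \<noteq> c" "l + 3 \<noteq> c"
  "j < l \<Longrightarrow> leaf_reg c j \<noteq> Suc l" "j < l \<Longrightarrow> leaf_reg c j \<noteq> Suc (Suc l)"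
  "j < l \<Longrightarrow> leaf_reg c j \<noteq> l + 3"
  "j < l \<Longrightarrow> Suc l \<noteq> leaf_reg c j" "j < l \<Longrightarrow> Suc (Suc l) \<noteq> leaf_reg c j"
  "j < l \<Longrightarrow> l + 3 \<noteq> leaf_reg c j"
  using c_le_l leaf_reg_le[of j l c] by auto

lemmas exec_simps = step_def prog_length length_data main_instrs regs_distinct quiet_def
  run_numeral take_bit_addr take_bit_small

section \<open>Paths through the main code\<close>

lemma advance:
  assumes "pc s = Suc 0" "quiet s" "wreg s c = 6 * i" "i < length recs"
  shows "\<exists>s'. exec_for 2 s = Some s' \<and> pc s' = 3 \<and> quiet s' \<and> wreg s' c = 6 * Suc i"
  using assms by (simp add: exec_simps)

lemma check_skip:
  assumes "pc s = 3" "quiet s" "wreg s c = 6 * i" "i < length recs"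
    and "recs ! i ! 3 = Word (6 * nx)" "0 < nx" "nx \<le> length recs"
    and "recs ! i ! 1 = Attr b" "x2 < b"
  shows "\<exists>s'. exec_for 11 s = Some s' \<and> pc s' = 3 \<and> quiet s' \<and> wreg s' c = 6 * nx"
  using assms data_nths[OF assms(4)] by (simp add: exec_simps)

lemma check_descend:
  assumes "pc s = 3" "quiet s" "wreg s c = 6 * i" "i < length recs"
    and "recs ! i ! 3 = Word (6 * nx)" "0 < nx"
    and "recs ! i ! 1 = Attr b" "b \<le> x2" "recs ! i ! 4 = Word 0"
  shows "\<exists>s'. exec_for 15 s = Some s' \<and> pc s' = 1 \<and> quiet s' \<and> wreg s' c = 6 * i"
  using assms data_nths[OF assms(4)] l_ge_2 by (simp add: exec_simps)

lemma check_leaf: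
  assumes "pc s = 3" "quiet s" "wreg s c = 6 * i" "i < length recs"
    and "recs ! i ! 3 = Word (6 * nx)" "0 < nx"
    and "recs ! i ! 1 = Attr b" "b \<le> x2" "recs ! i ! 4 = Word (6 * st)" "0 < st" "st < length recs"
    and "recs ! i ! 2 = Attr a" "recs ! i ! 5 = Word (6 * e)"
  shows "a < x1 \<Longrightarrow> \<exists>s'. exec_for 18 s = Some s' \<and> pc s' = 8"
    "x1 \<le> a \<Longrightarrow> \<exists>s'. exec_for 22 s = Some s' \<and> pc s' = 29 \<and> quiet s' \<and> wreg s' c = 6 * i \<and>
      wreg s' (leaf_reg c 0) = 6 * st \<and> wreg s' (leaf_reg c 1) = 6 * st \<and> wreg s' (l + 2) = 6 * e"
  using assms data_nths[OF assms(4)] l_ge_2 by (simp_all add: exec_simps)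

lemma check_halt:
  assumes "pc s = 3" "quiet s" "wreg s c = 6 * i" "i < length recs" "recs ! i ! 3 = Word 0"
  shows "\<exists>s'. exec_for 5 s = Some s' \<and> pc s' = 8"
  using assms data_nths[OF assms(4)] by (simp add: exec_simps)

lemma enum_halt: "pc s = 8 \<Longrightarrow> 0 < n \<Longrightarrow> enum n s []"
  by (rule enum_within_halt[where s' = "s\<lparr>pc := 9\<rparr>"]) (simp_all add: exec_simps)

section \<open>Backtracking over the leaves of a star\<close>

lemma level_instrs:
  assumes "1 \<le> j" "j < l"
  shows "prog ! (20 + 9 * j) = Const (l + 1) 6"
  "prog ! (21 + 9 * j) = Calc Add (leaf_reg c j) (leaf_reg c j) (l + 1)"
  "prog ! (22 + 9 * j) = Const (l + 1) (6 * (l - 1 - j) + 1)"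
  "prog ! (23 + 9 * j) = Calc Add (l + 1) (l + 1) (leaf_reg c j)"
  "prog ! (24 + 9 * j) = JumpLess (l + 1) (l + 2) (26 + 9 * j)"
  "prog ! (25 + 9 * j) = Jump (level_pc (j - 1))"
  "prog ! (26 + 9 * j) = LoadA 2 (l + 1)"
  "prog ! (27 + 9 * j) = JumpLessA 1 2 (level_pc (j - 1))"
  "prog ! (28 + 9 * j) = Calc Or (leaf_reg c (Suc j)) (leaf_reg c j) (leaf_reg c j)"
  using query_prog_level[OF assms, of 0 c] query_prog_level[OF assms, of 1 c]
    query_prog_level[OF assms, of 2 c] query_prog_level[OF assms, of 3 c]
    query_prog_level[OF assms, of 4 c] query_prog_level[OF assms, of 5 c]
    query_prog_level[OF assms, of 6 c] query_prog_level[OF assms, of 7 c]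
    query_prog_level[OF assms, of 8 c] assms
  by (simp_all add: level_code_def Let_def level_pc_def)

text \<open>The leaves at the positions \<open>ps\<close> are chosen. Registers of deeper levels are
  left open, so the property survives both a descent and the return from it.\<close>

definition framed :: "nat \<Rightarrow> nat \<Rightarrow> nat list \<Rightarrow> config \<Rightarrow> bool" where
  "framed i e ps s \<longleftrightarrow> quiet s \<and> wreg s c = 6 * i \<and> wreg s (l + 2) = 6 * e \<and>
     (\<forall>t<length ps. wreg s (leaf_reg c t) = 6 * ps ! t)"

text \<open>Level \<open>j\<close> moves its leaf from \<open>x\<close> to \<open>Suc x\<close>;
  \<open>y\<close> is where the last leaf lands if all remaining ones follow at once. When
  attributes are nondecreasing along the list, testing \<open>y\<close> alone decides whether the
  descent can be completed.\<close>

lemma level_step: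
  assumes j: "1 \<le> j" "j < l" "length ps = j" and x: "x < e" "e \<le> length recs"
    and s: "pc s = level_pc j" "framed i e ps s" "wreg s (leaf_reg c j) = 6 * x"
    and y: "y = Suc x + (l - 1 - j)" "y < e \<Longrightarrow> recs ! y ! 1 = Attr (attr y)"
  shows "y < e \<and> attr y \<le> x2 \<Longrightarrow> \<exists>s'. exec_for 8 s = Some s' \<and> pc s' = level_pc (Suc j) \<and>
      framed i e (ps @ [Suc x]) s' \<and> wreg s' (leaf_reg c (Suc j)) = 6 * Suc x"
    and "\<not> (y < e \<and> attr y \<le> x2) \<Longrightarrow> \<exists>n\<le>8. \<exists>s'. exec_for n s = Some s' \<and> pc s' = level_pc (j - 1) \<and>
      framed i e ps s'"
proof -
  have 1: "j \<noteq> 0" "\<And>t. t < j \<Longrightarrow> leaf_reg c t \<noteq> Suc l" "\<And>t. t < j \<Longrightarrow> leaf_reg c t \<noteq> leaf_reg c j"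
      "\<And>t. t < Suc j \<Longrightarrow> leaf_reg c t \<noteq> Suc l" "20 + 9 * j < 24 + 11 * l"
     "21 + 9 * j < 24 + 11 * l" "22 + 9 * j < 24 + 11 * l" "23 + 9 * j < 24 + 11 * l"
     "24 + 9 * j < 24 + 11 * l" "25 + 9 * j < 24 + 11 * l" "26 + 9 * j < 24 + 11 * l"
     "27 + 9 * j < 24 + 11 * l" "28 + 9 * j < 24 + 11 * l" "leaf_reg c (Suc j) \<noteq> Suc (Suc l)"
    using j regs_distinct(7) by (auto simp: leaf_reg_def)
  \<comment> \<open>The look-ahead address in the normal form that the simplifier produces. Being 1
    modulo 6, it is below \<open>6 * e\<close> exactly if \<open>y < e\<close>.\<close>
  let ?a = "7 + (6 * (l - Suc j) + 6 * x)"
  have a: "?a = Suc (6 * y)" using y(1) by simp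
  have "y < e \<Longrightarrow> data ! Suc (6 * y) = Attr (attr y)"
    using y(2) x data_nths(2)[of y] by simp
  then have 2: "y < e \<Longrightarrow> data ! ?a = Attr (attr y)" by (simp only: a)
  have 3: "?a < 6 * e \<and> ?a < 6 * length recs" if "y < e"
    using that x by (simp only: a, linarith)
  have 4: "\<not> ?a < 6 * e" if "\<not> y < e"
    using that unfolding a by linarith
  have 5: "take_bit w ?a = ?a" using x y(1) l_ge_2 by (intro take_bit_addr) auto
  { assume v: "y < e \<and> attr y \<le> x2"
    show "\<exists>s'. exec_for 8 s = Some s' \<and> pc s' = level_pc (Suc j) \<and>
      framed i e (ps @ [Suc x]) s' \<and> wreg s' (leaf_reg c (Suc j)) = 6 * Suc x"
      using v 1 s x j 2 3 5
      by (simp add: exec_simps level_instrs framed_def level_pc_def less_Suc_eq nth_append)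
  }
  { assume v: "\<not> (y < e \<and> attr y \<le> x2)"
    show "\<exists>n\<le>8. \<exists>s'. exec_for n s = Some s' \<and> pc s' = level_pc (j - 1) \<and> framed i e ps s'"
    proof (cases "y < e")
      case True
      show ?thesis
        apply (rule exI[of _ 7])
        using True v 1 s x j 2 3 5
        by (simp add: exec_simps level_instrs framed_def level_pc_def less_Suc_eq nth_append)
    next
      case False
      show ?thesis
        apply (rule exI[of _ 6])
        using False v 1 s x j 4 5
        by (simp add: exec_simps level_instrs framed_def level_pc_def less_Suc_eq nth_append)
    qed
  }
qed


lemma emit_instrs:
  assumes "r \<le> l"
  shows "prog ! (20 + 9 * l + 2 * r) = Load (l + 1) r"
    "prog ! Suc (20 + 9 * l + 2 * r) = Emit (l + 1)"
  using query_prog_emit[OF l_ge_2 assms, of 0] query_prog_emit[OF l_ge_2 assms, of 1]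
  by (simp_all add: emit_code_def)

lemma emit_run:
  assumes "pc s = 20 + 9 * l" "quiet s" "m \<le> Suc l"
    and "\<And>r. r \<le> l \<Longrightarrow> n r < length recs \<and> wreg s r = 6 * n r \<and> recs ! n r ! 0 = Word (g r)"
  shows "\<exists>s'. exec_for (2 * m) s = Some s' \<and> pc s' = 20 + 9 * l + 2 * m \<and>
    (\<forall>r. r \<noteq> Suc l \<longrightarrow> wreg s' r = wreg s r) \<and> areg s' = areg s \<and> mem s' = data \<and>
    buf s' = map g [0..<m]"
  using assms(3)
proof (induction m)
  case 0
  then show ?case using assms by (auto simp: quiet_def)
next
  case (Suc m)
  then obtain s1 where s1: "exec_for (2 * m) s = Some s1" "pc s1 = 20 + 9 * l + 2 * m"
    "\<And>r. r \<noteq> Suc l \<Longrightarrow> wreg s1 r = wreg s r" "areg s1 = areg s" "mem s1 = data"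
    "buf s1 = map g [0..<m]" by auto
  have m: "m \<le> l" "m \<noteq> Suc l" using Suc.prems by auto
  have n: "n m < length recs" "wreg s m = 6 * n m" "recs ! n m ! 0 = Word (g m)"
    using assms(4)[OF m(1)] by auto
  have "\<exists>s'. exec_for 2 s1 = Some s' \<and> pc s' = 20 + 9 * l + 2 * Suc m \<and>
    (\<forall>r. r \<noteq> Suc l \<longrightarrow> wreg s' r = wreg s r) \<and> areg s' = areg s \<and> mem s' = data \<and>
    buf s' = map g [0..<Suc m]"
    using s1 m n data_nths(1)[OF n(1)] emit_instrs[OF m(1)] by (simp add: exec_simps)
  with s1(1) run_add show ?case by (metis mult_Suc_right add.commute)
qed

text \<open>Two instructions per role and the report make up \<open>2 * l + 3\<close>. The jump back
  to level \<open>l - 1\<close> counts towards the next output, whence \<open>Suc m\<close>.\<close>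

lemma listing_report:
  assumes s: "pc s = level_pc l" "framed i e ps s" "length ps = l"
    and i: "i < length recs" "recs ! i ! 0 = Word v"
    and ps: "\<And>y. y \<in> set ps \<Longrightarrow> y < length recs \<and> recs ! y ! 0 = Word (ident y)"
    and cont: "\<And>s'. pc s' = level_pc (l - 1) \<Longrightarrow> framed i e ps s' \<Longrightarrow> enum m s' out"
    and bound: "real (Suc m) \<le> \<Delta>" "2 * l + 3 \<le> n"
  shows "enum n s (listing v ps # out)"
proof -
  define nd where "nd r = (if r = c then i else ps ! (if r < c then r else r - 1))" for r
  define g where "g r = (if r = c then v else ident (ps ! (if r < c then r else r - 1)))" for r
  have q: "(if r < c then r else r - 1) < l \<and> leaf_reg c (if r < c then r else r - 1) = r"
    if "r \<noteq> c" "r \<le> l" for r using that c_le_l l_ge_2 by (auto simp: leaf_reg_def)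
  have "nd r < length recs \<and> wreg s r = 6 * nd r \<and> recs ! nd r ! 0 = Word (g r)" if "r \<le> l" for r
  proof (cases "r = c")
    case True
    then show ?thesis using s i by (auto simp: nd_def g_def framed_def)
  next
    case False
    define t where "t = (if r < c then r else r - 1)"
    have t: "t < l" "leaf_reg c t = r" using q[OF False that] by (auto simp: t_def)
    moreover have "wreg s (leaf_reg c t) = 6 * ps ! t" using s t by (auto simp: framed_def)
    ultimately show ?thesis using ps[of "ps ! t"] s(3) False
      by (simp add: nd_def g_def flip: t_def)
  qed
  then obtain s1 where s1: "exec_for (2 * Suc l) s = Some s1" "pc s1 = 20 + 9 * l + 2 * Suc l"
    "\<And>r. r \<noteq> Suc l \<Longrightarrow> wreg s1 r = wreg s r" "areg s1 = areg s" "mem s1 = data"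
    "buf s1 = map g [0..<Suc l]"
    using emit_run[of s "Suc l" nd g] s l_ge_2 by (auto simp: level_pc_def framed_def simp del: upt_Suc)
  have out: "buf s1 = listing v ps" unfolding s1(6) star_listing_def g_def ..
  have p: "pc s1 = 22 + 11 * l" using s1(2) by simp
  define s2 where "s2 = s1\<lparr>pc := 23 + 11 * l, buf := []\<rparr>"
  have st: "step w (length data) prog s1 = Some (Output (listing v ps), s2)"
    using p out by (simp add: step_def prog_length query_prog_report[OF l_ge_2] s2_def)
  define s3 where "s3 = s2\<lparr>pc := level_pc (l - 1)\<rparr>"
  have r: "exec_for 1 s2 = Some s3"
    by (simp add: step_def prog_length query_prog_report[OF l_ge_2] s2_def s3_def)
  have "framed i e ps s3"
    using s s1(3-5) regs_distinct by (auto simp: framed_def s3_def s2_def quiet_def)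
  then have "enum m s3 out" by (intro cont) (auto simp: s3_def)
  then have "enum (Suc m) s2 out" by (rule enum_within_run[OF r]) simp
  then have "enum 1 s1 (listing v ps # out)"
    by (rule enum_within_report[OF st]) (use bound in auto)
  then show ?thesis by (rule enum_within_run[OF s1(1)]) (use bound in auto)
qed

text \<open>The second time limit applies if \<open>ps\<close> can be completed: every level then
  succeeds at its first attempt, and an output follows without backtracking. The first limit also
  covers failure: the return to level \<open>j - 1\<close> is charged 10 steps, and
  \<open>cont\<close> takes over. As \<open>T\<close> covers a full successful descent, both limits
  can be proved in one induction.\<close>

lemma levels:
  assumes i: "i < length recs" "recs ! i ! 0 = Word v"
    and e: "e \<le> length recs"
    and adj: "\<And>y. st \<le> y \<Longrightarrow> y < e \<Longrightarrow> recs ! y ! 0 = Word (ident y) \<and> recs ! y ! 1 = Attr (attr y)"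
    and f: "\<And>y. st \<le> y \<Longrightarrow> y < f \<longleftrightarrow> y < e \<and> attr y \<le> x2"
    and T: "12 * l + 3 \<le> T" "real (T + 10 * l + 1) \<le> \<Delta>"
    and j: "1 \<le> j" "j + r = l"
    and ps: "length ps = j" "set ps \<subseteq> {st..<e}" "st \<le> x" "x < e"
    and s: "pc s = level_pc j" "framed i e ps s" "wreg s (leaf_reg c j) = 6 * x"
    and cont: "\<And>s'. pc s' = level_pc (j - 1) \<Longrightarrow> framed i e ps s' \<Longrightarrow> enum (T + 10 * (j - 1)) s' out"
  shows "enum (T + 10 * j) s (map (\<lambda>q. listing v (ps @ q)) (subseqs_between r (Suc x) f) @ out) \<and>
    (x + r < f \<longrightarrow>
      enum (10 * r + 2 * l + 3) s (map (\<lambda>q. listing v (ps @ q)) (subseqs_between r (Suc x) f) @ out))"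
  using j ps s cont
proof (induction r arbitrary: j ps x s out)
  case 0
  have "enum n s (listing v ps # out)" if "2 * l + 3 \<le> n" for n
  proof (rule listing_report[of s i e ps v "T + 10 * (l - 1)" out])
    show "real (Suc (T + 10 * (l - 1))) \<le> \<Delta>" using T(2) l_ge_2 by linarith
    show "y < length recs \<and> recs ! y ! 0 = Word (ident y)" if "y \<in> set ps" for y
      using 0 that adj[of y] e by auto
  qed (use 0 i that in auto)
  from this[of "2 * l + 3"] this[of "T + 10 * j"] show ?case using T 0 by auto
next
  case (Suc r)
  have j': "j < l" using Suc.prems by simp
  show ?case using Suc.prems(5-)
  \<comment> \<open>For a fixed number \<open>Suc r\<close> of missing leaves, the inner induction
    lets the pointer \<open>x\<close> move towards the end of the list.\<close>
  proof (induction "e - x" arbitrary: x s rule: less_induct)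
    case less
    define y where "y = Suc x + r"
    have y: "y = Suc x + (l - 1 - j)" using Suc.prems(2) by (simp add: y_def)
    have ry: "y < e \<Longrightarrow> recs ! y ! 1 = Attr (attr y)" using adj[of y] less.prems by (simp add: y_def)
    note ls = level_step[OF Suc.prems(1) j' Suc.prems(3) \<open>x < e\<close> e less.prems(3,4,5) y ry]
    have fy: "y < f \<longleftrightarrow> y < e \<and> attr y \<le> x2" using f[of y] less.prems by (simp add: y_def)
    show ?case
    proof (cases "y < f")
      case True
      with ls(1) fy obtain s' where s': "exec_for 8 s = Some s'" "pc s' = level_pc (Suc j)"
        "framed i e (ps @ [Suc x]) s'" "wreg s' (leaf_reg c (Suc j)) = 6 * Suc x" by auto
      have xe: "Suc x < e" using fy True by (simp add: y_def)
      \<comment> \<open>The output still to come after all lists that place the next leaf at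
        \<open>Suc x\<close>. The outer hypothesis needs it as its continuation, and the inner
        hypothesis provides it.\<close>
      let ?A = "map (\<lambda>q. listing v (ps @ q)) (subseqs_between (Suc r) (Suc (Suc x)) f) @ out"
      have "enum (T + 10 * Suc j) s' (map (\<lambda>q. listing v ((ps @ [Suc x]) @ q)) (subseqs_between r (Suc (Suc x)) f) @ ?A) \<and>
       (Suc x + r < f \<longrightarrow>
        enum (10 * r + 2 * l + 3) s' (map (\<lambda>q. listing v ((ps @ [Suc x]) @ q)) (subseqs_between r (Suc (Suc x)) f) @ ?A))"
      proof (rule Suc.IH)
        fix s1 assume s1: "pc s1 = level_pc (Suc j - 1)" "framed i e (ps @ [Suc x]) s1"
        have fr: "framed i e ps s1" using s1 by (auto simp: framed_def nth_append less_Suc_eq)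
        \<comment> \<open>On return, the register of level \<open>j\<close> still holds the last
          entry of \<open>ps @ [Suc x]\<close>.\<close>
        have wr: "wreg s1 (leaf_reg c j) = 6 * Suc x"
          using s1(2) Suc.prems(3) unfolding framed_def by (metis length_append_singleton lessI nth_append_length)
        have "enum (T + 10 * j) s1 ?A"
          by (rule less.hyps[THEN conjunct1]) (use less.prems xe s1 fr wr in auto)
        then show "enum (T + 10 * (Suc j - 1)) s1 ?A" by simp
      qed (use Suc.prems s' less.prems xe in auto)
      then have "enum (10 * r + 2 * l + 3) s' (map (\<lambda>q. listing v ((ps @ [Suc x]) @ q)) (subseqs_between r (Suc (Suc x)) f) @ ?A)"
        using True by (simp add: y_def)
      moreover have "map (\<lambda>q. listing v ((ps @ [Suc x]) @ q)) (subseqs_between r (Suc (Suc x)) f) @ ?A =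
        map (\<lambda>q. listing v (ps @ q)) (subseqs_between (Suc r) (Suc x) f) @ out"
        using True by (simp add: subseqs_between.simps(2)[of r "Suc x"] y_def)
      ultimately have *: "enum (10 * r + 2 * l + 3) s' (map (\<lambda>q. listing v (ps @ q)) (subseqs_between (Suc r) (Suc x) f) @ out)"
        by (rule back_subst[where P = "enum (10 * r + 2 * l + 3) s'"])
      \<comment> \<open>A direct descent thus costs at most \<open>12 * l + 3\<close>, which
        \<open>T\<close> covers.\<close>
      have "10 * Suc r \<le> 10 * l" using Suc.prems(2) by simp
      then show ?thesis
        by (intro conjI impI; intro enum_within_run[OF s'(1) *]) (use T(1) in auto)
    next
      case False
      with ls(2) fy obtain n s' where s': "n \<le> 8" "exec_for n s = Some s'" "pc s' = level_pc (j - 1)"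
        "framed i e ps s'" by auto
      have "enum (T + 10 * j) s out"
        by (rule enum_within_run[OF s'(2) less.prems(6)[OF s'(3,4)]]) (use s'(1) Suc.prems(1) in auto)
      then show ?thesis using False by (simp add: subseqs_between.simps(2)[of r "Suc x"] y_def)
    qed
  qed
qed

end


section \<open>The search tree\<close>

text \<open>A point stands for the stars with a given centre whose first leaf is the record \<open>start\<close> of
  the adjacency list of the centre; \<open>stop\<close> is the end of this list.\<close>

datatype point = Point (centre: nat) (lo: real) (hi: real) (start: nat) (stop: nat)

datatype ptree = Leaf point | Node ptree ptree

primrec leaves :: "ptree \<Rightarrow> point list" where
  "leaves (Leaf p) = [p]"
| "leaves (Node a b) = leaves a @ leaves b"

primrec tree_size :: "ptree \<Rightarrow> nat" where
  "tree_size (Leaf p) = 1"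
| "tree_size (Node a b) = Suc (tree_size a + tree_size b)"

primrec tree_height :: "ptree \<Rightarrow> nat" where
  "tree_height (Leaf p) = 0"
| "tree_height (Node a b) = Suc (max (tree_height a) (tree_height b))"

primrec tree_min :: "ptree \<Rightarrow> real" where
  "tree_min (Leaf p) = hi p"
| "tree_min (Node a b) = min (tree_min a) (tree_min b)"

text \<open>Cell 3 of a record is the address of the first record behind its subtree, and \<open>0\<close> in cell 4
  marks inner nodes. No adjacency list starts at address \<open>0\<close>, where the tree is stored.\<close>

definition leaf_record :: "nat \<Rightarrow> point \<Rightarrow> cell list" where
  "leaf_record i p = [Word (centre p), Attr (hi p), Attr (lo p), Word (6 * Suc i),
     Word (6 * start p), Word (6 * stop p)]"

definition node_record :: "nat \<Rightarrow> ptree \<Rightarrow> cell list" where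
  "node_record i t = [Word 0, Attr (tree_min t), Attr (tree_min t), Word (6 * (i + tree_size t)),
     Word 0, Word 0]"

primrec tree_records :: "nat \<Rightarrow> ptree \<Rightarrow> cell list list" where
  "tree_records i (Leaf p) = [leaf_record i p]"
| "tree_records i (Node a b) =
     node_record i (Node a b) # tree_records (Suc i) a @ tree_records (Suc i + tree_size a) b"

primrec placed :: "cell list list \<Rightarrow> nat \<Rightarrow> ptree \<Rightarrow> bool" where
  "placed recs i (Leaf p) \<longleftrightarrow> recs ! i = leaf_record i p"
| "placed recs i (Node a b) \<longleftrightarrow> recs ! i = node_record i (Node a b) \<and> placed recs (Suc i) a \<and>
     placed recs (Suc i + tree_size a) b"

lemma length_tree_records [simp]: "length (tree_records i t) = tree_size t"
  by (induction t arbitrary: i) auto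

lemma placed_tree_records:
  "length us = i \<Longrightarrow> placed (us @ tree_records i t @ vs) i t"
proof (induction t arbitrary: i us vs)
  case (Leaf p)
  then show ?case by (simp add: nth_append)
next
  case (Node a b)
  let ?r = "us @ tree_records i (Node a b) @ vs"
  have "placed ((us @ [node_record i (Node a b)]) @ tree_records (Suc i) a @
      tree_records (Suc i + tree_size a) b @ vs) (Suc i) a"
    by (rule Node.IH(1)) (simp add: Node.prems)
  moreover have "placed ((us @ node_record i (Node a b) # tree_records (Suc i) a) @
      tree_records (Suc i + tree_size a) b @ vs) (Suc i + tree_size a) b"
    by (rule Node.IH(2)) (simp add: Node.prems)
  moreover have "?r ! i = node_record i (Node a b)"
    using Node.prems by (simp add: nth_append)
  ultimately show ?case by simp
qed

lemma tree_size_leaves: "Suc (tree_size t) = 2 * length (leaves t)"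
  by (induction t) auto

text \<open>The minimum stored at an inner node is attained at a leaf below it, so it is again a
  coordinate of a point. This keeps all stored reals among the attributes and all words within
  bounds.\<close>

lemma tree_records_cells:
  assumes "r \<in> set (tree_records i t)"
  shows "length r = 6"
    and "Attr x \<in> set r \<Longrightarrow> \<exists>p\<in>set (leaves t). x = lo p \<or> x = hi p"
    and "Word y \<in> set r \<Longrightarrow> y \<le> 6 * (i + tree_size t) \<or>
      (\<exists>p\<in>set (leaves t). y = centre p \<or> y = 6 * start p \<or> y = 6 * stop p)"
proof -
  show "length r = 6" using assms
    by (induction t arbitrary: i) (auto simp: leaf_record_def node_record_def)
  have min: "\<exists>p\<in>set (leaves t). tree_min t = hi p" for t
    by (induction t) (auto simp: min_def)
  show "\<exists>p\<in>set (leaves t). x = lo p \<or> x = hi p" if "Attr x \<in> set r"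
    using assms that
  proof (induction t arbitrary: i)
    case (Node a b)
    then show ?case using min[of "Node a b"] by (fastforce simp: node_record_def)
  qed (auto simp: leaf_record_def)
  show "y \<le> 6 * (i + tree_size t) \<or>
      (\<exists>p\<in>set (leaves t). y = centre p \<or> y = 6 * start p \<or> y = 6 * stop p)" if "Word y \<in> set r"
    using assms that
  proof (induction t arbitrary: i)
    case (Node a b)
    from Node.prems(1) consider "r = node_record i (Node a b)" | "r \<in> set (tree_records (Suc i) a)"
      | "r \<in> set (tree_records (Suc i + tree_size a) b)" by auto
    then show ?case
    proof cases
      case 2
      from Node.IH(1)[OF 2 Node.prems(2)] show ?thesis by auto
    next
      case 3
      from Node.IH(2)[OF 3 Node.prems(2)] show ?thesis by auto
    qed (use Node.prems(2) in \<open>auto simp: node_record_def\<close>)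
  qed (auto simp: leaf_record_def)
qed

text \<open>\<open>h\<close> bounds the height: \<open>h\<close> halvings reduce a list of length at
  most \<open>2 ^ h\<close> to single points.\<close>

fun build :: "nat \<Rightarrow> point list \<Rightarrow> ptree" where
  "build 0 xs = Leaf (hd xs)"
| "build (Suc h) xs = (let n = length xs div 2 in
     if length xs \<le> 1 then Leaf (hd xs) else Node (build h (take n xs)) (build h (drop n xs)))"

lemma build:
  assumes "xs \<noteq> []" "length xs \<le> 2 ^ h"
  shows "leaves (build h xs) = xs \<and> tree_height (build h xs) \<le> h"
  using assms
proof (induction h arbitrary: xs)
  case 0
  then show ?case by (cases xs) auto
next
  case (Suc h)
  show ?case
  proof (cases "length xs \<le> 1")
    case True
    with Suc.prems show ?thesis by (cases xs) auto
  next
    case False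
    define n where "n = length xs div 2"
    have "take n xs \<noteq> []" "drop n xs \<noteq> []" "length (take n xs) \<le> 2 ^ h" "length (drop n xs) \<le> 2 ^ h"
      using False Suc.prems by (auto simp: n_def)
    with Suc.IH[of "take n xs"] Suc.IH[of "drop n xs"] False show ?thesis
      by (simp add: n_def Let_def)
  qed
qed

section \<open>Traversal of the search tree\<close>

context query_machine
begin

text \<open>\<open>bnd p\<close> is where the adjacency list of the centre leaves the range
  \<open>attr y \<le> x2\<close>. By the last condition, \<open>l\<close> consecutive leaves from
  \<open>start p\<close> on lie before it if \<open>hi p \<le> x2\<close>, so entering such a group
  is never fruitless.\<close>

definition valid_point :: "(point \<Rightarrow> nat) \<Rightarrow> point \<Rightarrow> bool" where
  "valid_point bnd p \<longleftrightarrow> 0 < start p \<and> start p < stop p \<and> stop p \<le> length recs \<and>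
     (\<forall>y. start p \<le> y \<and> y < stop p \<longrightarrow> recs ! y ! 0 = Word (ident y) \<and> recs ! y ! 1 = Attr (attr y)) \<and>
     (\<forall>y. start p \<le> y \<longrightarrow> (y < bnd p \<longleftrightarrow> y < stop p \<and> attr y \<le> x2)) \<and>
     (hi p \<le> x2 \<longrightarrow> start p + (l - 1) < bnd p)"

definition stars :: "(point \<Rightarrow> nat) \<Rightarrow> point \<Rightarrow> nat list list" where
  "stars bnd p = map (\<lambda>q. listing (centre p) (start p # q)) (subseqs_between (l - 1) (Suc (start p)) (bnd p))"

text \<open>The tests come in the order of the program: \<open>lo p\<close> is compared only at
  points with \<open>hi p \<le> x2\<close>, and a failure there ends the query.\<close>

primrec found :: "(point \<Rightarrow> nat) \<Rightarrow> point list \<Rightarrow> nat list list" where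
  "found bnd [] = []"
| "found bnd (p # ps) =
    (if hi p \<le> x2 then (if lo p < x1 then [] else stars bnd p @ found bnd ps) else found bnd ps)"

text \<open>As \<open>lo\<close> does not increase along the list, all points behind one with
  \<open>lo p < x1\<close> fail the same test, so halting there loses nothing.\<close>

lemma found_sorted:
  assumes "sorted_wrt (\<lambda>p q. lo q \<le> lo p) ps"
  shows "found bnd ps = concat (map (stars bnd) (filter (\<lambda>p. x1 \<le> lo p \<and> hi p \<le> x2) ps))"
  using assms
proof (induction ps)
  case (Cons p ps)
  have "filter (\<lambda>p. x1 \<le> lo p \<and> hi p \<le> x2) ps = []" if "lo p < x1"
    using that Cons.prems by (fastforce simp: filter_empty_conv)
  with Cons show ?case by auto
qed simp

lemma found_skip: "x2 < tree_min t \<Longrightarrow> found bnd (leaves t @ ps) = found bnd ps"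
  by (induction t arbitrary: ps) auto

text \<open>22 instructions lead to level \<open>1\<close>, where \<open>hi p \<le> x2\<close>
  guarantees a descent without backtracking; otherwise the query halts even earlier.\<close>

lemma leaf_run:
  assumes T: "12 * l + 3 \<le> T" "real (T + 10 * l + 1) \<le> \<Delta>"
    and p: "recs ! i = leaf_record i p" "valid_point bnd p" "Suc i < length recs" "hi p \<le> x2"
    and s: "pc s = 3" "quiet s" "wreg s c = 6 * i"
    and cont: "\<And>s'. pc s' = 3 \<Longrightarrow> quiet s' \<Longrightarrow> wreg s' c = 6 * Suc i \<Longrightarrow> enum n s' (found bnd rest)"
    and n: "n + 2 \<le> T"
  shows "enum (12 * l + 30) s (found bnd (p # rest))"
proof -
  note v = p(2)[unfolded valid_point_def]
  have i: "i < length recs" using p by simp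
  have r: "recs ! i ! 3 = Word (6 * Suc i)" "0 < Suc i" "recs ! i ! 1 = Attr (hi p)"
    "recs ! i ! 4 = Word (6 * start p)" "0 < start p" "start p < length recs"
    "recs ! i ! 2 = Attr (lo p)" "recs ! i ! 5 = Word (6 * stop p)" "recs ! i ! 0 = Word (centre p)"
    using p v by (auto simp: leaf_record_def)
  note check = check_leaf[OF s i r(1-3) p(4) r(4-8)]
  show ?thesis
  proof (cases "lo p < x1")
    case True
    with check(1) obtain s1 where s1: "exec_for 18 s = Some s1" "pc s1 = 8" by auto
    have "enum 1 s1 []" by (rule enum_halt[OF s1(2)]) simp
    then have "enum (12 * l + 30) s []" by (rule enum_within_run[OF s1(1)]) simp
    with True p show ?thesis by simp
  next
    case False
    with check(2) obtain s1 where s1: "exec_for 22 s = Some s1" "pc s1 = 29" "quiet s1"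
      "wreg s1 c = 6 * i" "wreg s1 (leaf_reg c 0) = 6 * start p"
      "wreg s1 (leaf_reg c 1) = 6 * start p" "wreg s1 (l + 2) = 6 * stop p" by auto
    let ?out = "map (\<lambda>q. listing (centre p) ([start p] @ q)) (subseqs_between (l - 1) (Suc (start p)) (bnd p)) @ found bnd rest"
    have "enum (T + 10 * 1) s1 ?out \<and>
      (start p + (l - 1) < bnd p \<longrightarrow> enum (10 * (l - 1) + 2 * l + 3) s1 ?out)"
    proof (rule levels[where st = "start p" and e = "stop p" and i = i])
      fix s' assume "pc s' = level_pc (1 - 1)" and fr: "framed i (stop p) [start p] s'"
      then have "pc s' = Suc 0" "quiet s'" "wreg s' c = 6 * i" by (auto simp: level_pc_def framed_def)
      from advance[OF this i] obtain s2 where s2: "exec_for 2 s' = Some s2" "pc s2 = 3" "quiet s2"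
        "wreg s2 c = 6 * Suc i" by auto
      show "enum (T + 10 * (1 - 1)) s' (found bnd rest)"
        by (rule enum_within_run[OF s2(1) cont[OF s2(2-4)]]) (use n in auto)
    next
      show "\<And>y. start p \<le> y \<Longrightarrow> y < stop p \<Longrightarrow> recs ! y ! 0 = Word (ident y) \<and> recs ! y ! 1 = Attr (attr y)"
        using v by blast
      show "\<And>y. start p \<le> y \<Longrightarrow> y < bnd p \<longleftrightarrow> y < stop p \<and> attr y \<le> x2"
        using v by blast
      show "12 * l + 3 \<le> T" "real (T + 10 * l + 1) \<le> \<Delta>" by fact+
    qed (use i r v s1 l_ge_2 in \<open>auto simp: level_pc_def framed_def\<close>)
    then have "enum (10 * (l - 1) + 2 * l + 3) s1 ?out" using v p(4) by blast
    then have "enum (12 * l + 30) s ?out" by (rule enum_within_run[OF s1(1)]) (use l_ge_2 in auto)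
    with False p(4) show ?thesis by (simp add: stars_def)
  qed
qed

text \<open>\<open>d\<close> counts the right subtrees still pending; skipping one is charged 20
  steps, which gives the first limit. If \<open>tree_min t \<le> x2\<close>, the next event lies
  straight below: each node on the way costs at most 40 steps, for entering the left child and, if
  the minimum there is too large, skipping it in favour of the right child.\<close>

lemma tree_run:
  assumes T: "12 * l + 30 + 40 * H \<le> T" "real (T + 20 * H + 10 * l + 3) \<le> \<Delta>"
    and t: "placed recs i t" "\<forall>p\<in>set (leaves t). valid_point bnd p" "i + tree_size t < length recs"
      "d + tree_height t \<le> H"
    and s: "pc s = 3" "quiet s" "wreg s c = 6 * i"
    and cont: "\<And>s'. pc s' = 3 \<Longrightarrow> quiet s' \<Longrightarrow> wreg s' c = 6 * (i + tree_size t) \<Longrightarrow>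
      enum (T + 20 * d) s' (found bnd rest)"
  shows "enum (T + 20 * Suc d) s (found bnd (leaves t @ rest)) \<and>
    (tree_min t \<le> x2 \<longrightarrow>
       enum (40 * tree_height t + 12 * l + 30) s (found bnd (leaves t @ rest)))"
  using t s cont
proof (induction t arbitrary: i d s rest)
  case (Leaf p)
  have Li: "Suc i < length recs" "i < length recs" "recs ! i = leaf_record i p" using Leaf.prems by auto
  show ?case
  proof (cases "hi p \<le> x2")
    case True
    have "enum (12 * l + 30) s (found bnd (p # rest))"
    \<comment> \<open>The additional 2 pays for moving to the next record once the group is
      exhausted.\<close>
    proof (rule leaf_run[where T = "T + 20 * d + 2" and n = "T + 20 * d"])
      show "enum (T + 20 * d) s' (found bnd rest)"
        if "pc s' = 3" "quiet s'" "wreg s' c = 6 * Suc i" for s'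
        using Leaf.prems(8)[OF that(1,2)] that(3) by simp
      show "real (T + 20 * d + 2 + 10 * l + 1) \<le> \<Delta>" using T Leaf.prems(4) by simp
    qed (use Leaf.prems Li T True in auto)
    moreover from this have "enum (T + 20 * Suc d) s (found bnd (p # rest))"
      by (rule enum_within_mono) (use T in simp)
    ultimately show ?thesis by (simp del: found.simps)
  next
    case False
    then obtain s1 where s1: "exec_for 11 s = Some s1" "pc s1 = 3" "quiet s1" "wreg s1 c = 6 * Suc i"
      using check_skip[OF Leaf.prems(5-7) Li(2), of "Suc i" "hi p"] Li
      by (auto simp: leaf_record_def)
    have "enum (T + 20 * Suc d) s (found bnd rest)"
      by (rule enum_within_run[OF s1(1) Leaf.prems(8)[OF s1(2,3)]]) (use s1(4) in auto)
    with False show ?thesis by simp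
  qed
next
  case (Node a b)
  let ?t = "Node a b"
  have Ni: "i + tree_size ?t < length recs" "i < length recs" "recs ! i = node_record i ?t"
    using Node.prems by auto
  show ?case
  proof (cases "tree_min ?t \<le> x2")
    case True
    obtain s1 where s1: "exec_for 15 s = Some s1" "pc s1 = Suc 0" "quiet s1" "wreg s1 c = 6 * i"
      using check_descend[OF Node.prems(5-7) Ni(2), of "i + tree_size ?t" "tree_min ?t"] Ni True
      by (auto simp: node_record_def)
    from advance[OF s1(2-4) Ni(2)] obtain s2 where s2: "exec_for 2 s1 = Some s2" "pc s2 = 3" "quiet s2"
      "wreg s2 c = 6 * Suc i" by auto
    have r: "exec_for (15 + 2) s = Some s2" by (rule run_add[OF s1(1) s2(1)])
    have B: "enum (T + 20 * Suc d) s' (found bnd (leaves b @ rest)) \<and> (tree_min b \<le> x2 \<longrightarrow>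
       enum (40 * tree_height b + 12 * l + 30) s' (found bnd (leaves b @ rest)))"
      if "pc s' = 3" "quiet s'" "wreg s' c = 6 * (Suc i + tree_size a)" for s'
      by (rule Node.IH(2)[OF _ _ _ _ that]) (use Node.prems in auto)
    have A: "enum (T + 20 * Suc (Suc d)) s' (found bnd (leaves a @ leaves b @ rest)) \<and> (tree_min a \<le> x2 \<longrightarrow>
       enum (40 * tree_height a + 12 * l + 30) s' (found bnd (leaves a @ leaves b @ rest)))"
      if "pc s' = 3" "quiet s'" "wreg s' c = 6 * Suc i" for s'
      by (rule Node.IH(1)[OF _ _ _ _ that]) (use Node.prems B in auto)
    have "enum (40 * tree_height ?t + 12 * l + 30) s (found bnd (leaves a @ leaves b @ rest))"
    proof (cases "tree_min a \<le> x2")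
      case True
      with A[OF s2(2-4)] have "enum (40 * tree_height a + 12 * l + 30) s2 (found bnd (leaves a @ leaves b @ rest))"
        by blast
      then show ?thesis by (rule enum_within_run[OF r]) auto
    next
      case False
      with True have b: "tree_min b \<le> x2" by auto
      have pa: "placed recs (Suc i) a" using Node.prems by simp
      have "\<exists>n\<le>11. \<exists>s3. exec_for n s2 = Some s3 \<and> pc s3 = 3 \<and> quiet s3 \<and> wreg s3 c = 6 * (Suc i + tree_size a)"
      proof (rule exI[of _ 11], rule conjI)
        \<comment> \<open>Tree leaves and inner nodes keep skip address and minimum in the same
          cells, so one skipping path serves both.\<close>
        have "recs ! Suc i ! 3 = Word (6 * (Suc i + tree_size a)) \<and> recs ! Suc i ! 1 = Attr (tree_min a)"
          using pa by (cases a) (auto simp: leaf_record_def node_record_def)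
        then show "\<exists>s3. exec_for 11 s2 = Some s3 \<and> pc s3 = 3 \<and> quiet s3 \<and> wreg s3 c = 6 * (Suc i + tree_size a)"
          using Ni(1) False
          by (intro check_skip[OF s2(2-4), of "Suc i + tree_size a" "tree_min a"]) auto
      qed simp
      then obtain n s3 where s3: "n \<le> 11" "exec_for n s2 = Some s3" "pc s3 = 3" "quiet s3"
        "wreg s3 c = 6 * (Suc i + tree_size a)" by blast
      have "enum (40 * tree_height b + 12 * l + 30) s3 (found bnd (leaves b @ rest))"
        using B[OF s3(3-5)] b by blast
      then have "enum (11 + (40 * tree_height b + 12 * l + 30)) s2 (found bnd (leaves b @ rest))"
        by (rule enum_within_run[OF s3(2)]) (use s3(1) in simp)
      then have "enum (40 * tree_height ?t + 12 * l + 30) s (found bnd (leaves b @ rest))"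
        by (rule enum_within_run[OF r]) auto
      then show ?thesis using False found_skip[of a] by simp
    qed
    moreover from this have "enum (T + 20 * Suc d) s (found bnd (leaves a @ leaves b @ rest))"
      by (rule enum_within_mono) (use T(1) Node.prems(4) in linarith)
    ultimately show ?thesis by simp
  next
    case False
    then have mn: "x2 < tree_min ?t" by (simp only: not_le)
    obtain s1 where s1: "exec_for 11 s = Some s1" "pc s1 = 3" "quiet s1"
      "wreg s1 c = 6 * (i + tree_size ?t)"
      using check_skip[OF Node.prems(5-7) Ni(2), of "i + tree_size ?t" "tree_min ?t"] Ni mn
      by (auto simp: node_record_def)
    have "enum (T + 20 * Suc d) s (found bnd rest)"
      by (rule enum_within_run[OF s1(1) Node.prems(8)[OF s1(2-4)]]) simp
    with False show ?thesis unfolding found_skip[OF mn] by simp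
  qed
qed

text \<open>Record \<open>n\<close>, directly behind the tree, halts the program by its skip address
  \<open>0\<close>; without any points it is the very first record.\<close>

lemma query_run:
  assumes n: "(ps = [] \<and> n = 0) \<or>
      (\<exists>t. leaves t = ps \<and> placed recs 0 t \<and> tree_size t = n \<and> tree_height t \<le> H)"
    and halt: "n < length recs" "recs ! n ! 3 = Word 0"
    and valid: "\<forall>p\<in>set ps. valid_point bnd p"
    and bound: "real (60 * H + 22 * l + 60) \<le> \<Delta>"
  shows "enumerates w (length data) prog \<Delta> (query_config x1 x2 data) (found bnd ps)"
proof -
  \<comment> \<open>With this choice, the limit required by \<open>tree_run\<close> is
    \<open>60 * H + 22 * l + 33\<close>.\<close>
  define T where "T = 12 * l + 30 + 40 * H"
  define s where "s = (query_config x1 x2 data)\<lparr>pc := 3\<rparr>"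
  have s: "pc s = 3" "quiet s" "wreg s c = 6 * 0" by (auto simp: s_def query_config_def quiet_def)
  have r: "exec_for 1 (query_config x1 x2 data) = Some s"
    by (simp add: step_def main_instrs prog_length s_def query_config_def)
  have h: "enum T s' (found bnd [])" if st: "pc s' = 3" "quiet s'" "wreg s' c = 6 * n" for s'
  proof -
    from check_halt[OF st halt] obtain s1 where s1: "exec_for 5 s' = Some s1" "pc s1 = 8" by auto
    have "enum 1 s1 []" by (rule enum_halt[OF s1(2)]) simp
    then have "enum T s' []" by (rule enum_within_run[OF s1(1)]) (simp add: T_def)
    then show ?thesis by simp
  qed
  have "enum (T + 20) s (found bnd ps)"
    using n
  proof (elim disjE exE conjE)
    assume "ps = []" "n = 0"
    with h[of s] s show ?thesis by (auto intro: enum_within_mono)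
  next
    fix t assume t: "leaves t = ps" "placed recs 0 t" "tree_size t = n" "tree_height t \<le> H"
    have "enum (T + 20 * Suc 0) s (found bnd (leaves t @ []))"
    proof (rule conjunct1[OF tree_run[where H = H and i = 0]])
      show "real (T + 20 * H + 10 * l + 3) \<le> \<Delta>" using bound by (simp add: T_def)
    qed (use t s valid halt h in \<open>auto simp: T_def\<close>)
    with t show ?thesis by simp
  qed
  then have "enum (T + 21) (query_config x1 x2 data) (found bnd ps)"
    by (rule enum_within_run[OF r]) simp
  then show ?thesis by (rule enum_within_enumerates) (use bound in \<open>simp add: T_def\<close>)
qed

end


section \<open>Stars\<close>

text \<open>A leaf has one neighbour. If that were another leaf, the two would form a component
  without the centre \<open>c\<close>, against connectedness; so all leaves hang on
  \<open>c\<close>. For \<open>l = 1\<close> the centre would have degree 1 and be a leaf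
  itself.\<close>

lemma star_shape:
  fixes Q :: "nat ugraph"
  assumes "l \<ge> 1" "star l Q" "verts Q = {..<k}"
  obtains c where "c < k" "k = Suc l" "2 \<le> l" "edges Q = (\<lambda>i. {c, i}) ` ({..<k} - {c})"
proof -
  have simple: "simple_graph Q" and conn: "connected_graph Q" and card: "card {v. leaf Q v} = l"
    and "\<exists>!v. v \<in> verts Q \<and> \<not> leaf Q v"
    using assms(2) by (auto simp: star_def tree_def)
  then obtain c where c: "c \<in> verts Q" "\<not> leaf Q c" "\<And>v. v \<in> verts Q \<Longrightarrow> v \<noteq> c \<Longrightarrow> leaf Q v"
    by blast
  have ck: "c < k" using c assms by auto
  have lv: "{v. leaf Q v} = {..<k} - {c}" using c assms(3) by (auto simp: leaf_def)
  have k: "k = Suc l" using card ck by (simp add: lv)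
  have e2: "\<And>e. e \<in> edges Q \<Longrightarrow> e \<subseteq> {..<k} \<and> card e = 2" using simple assms(3) by (auto simp: simple_graph_def)
  have ci: "{c, i} \<in> edges Q \<and> (\<forall>e\<in>edges Q. i \<in> e \<longrightarrow> e = {c, i})" if i: "i < k" "i \<noteq> c" for i
  proof -
    have "degree Q i = 1" using c(3)[of i] i assms(3) by (auto simp: leaf_def)
    then obtain e where e: "{e \<in> edges Q. i \<in> e} = {e}" unfolding degree_def by (metis card_1_singletonE)
    then have ie: "e \<in> edges Q" "i \<in> e" by auto
    have card2: "card e = 2" using e2[OF ie(1)] by simp
    obtain j where j: "e = {i, j}" "j \<noteq> i"
      using card2 ie(2) by (auto simp: card_2_iff)
    have "j = c"
    proof (rule ccontr)
      assume jc: "j \<noteq> c"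
      have jk: "j < k" using e2[OF ie(1)] j by auto
      have "degree Q j = 1" using c(3)[of j] jk jc assms(3) by (auto simp: leaf_def)
      then obtain e' where e': "{e \<in> edges Q. j \<in> e} = {e'}" unfolding degree_def by (metis card_1_singletonE)
      moreover have "e \<in> {e \<in> edges Q. j \<in> e}" using ie(1) j(1) by simp
      ultimately have e'e: "e' = e" by simp
      have "(\<lambda>a b. {a, b} \<in> edges Q)\<^sup>*\<^sup>* i b \<Longrightarrow> b \<in> {i, j}" for b
      proof (induction rule: rtranclp_induct)
        case (step y z)
        then have "{y, z} \<in> {e \<in> edges Q. i \<in> e} \<or> {y, z} \<in> {e \<in> edges Q. j \<in> e}" by auto
        then have "{y, z} = e" unfolding e e' e'e by simp
        then show ?case using j by (simp add: doubleton_eq_iff) blast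
      qed simp
      moreover have "(\<lambda>a b. {a, b} \<in> edges Q)\<^sup>*\<^sup>* i c"
        using conn i ck assms(3) by (auto simp: connected_graph_def)
      ultimately show False using jc i by auto
    qed
    then show ?thesis using ie e j by (auto simp: insert_commute)
  qed
  have edges: "edges Q = (\<lambda>i. {c, i}) ` ({..<k} - {c})"
  proof
    show "edges Q \<subseteq> (\<lambda>i. {c, i}) ` ({..<k} - {c})"
    proof
      fix e assume e: "e \<in> edges Q"
      then obtain x y where xy: "e = {x, y}" "x \<noteq> y" using e2 by (meson card_2_iff)
      then have "x < k" "y < k" using e2[OF e] by auto
      then show "e \<in> (\<lambda>i. {c, i}) ` ({..<k} - {c})"
        using ci[of x] ci[of y] e xy by (cases "x = c") auto
    qed
  qed (use ci in auto)
  have "l \<noteq> 1"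
  proof
    assume "l = 1"
    then have "card ({..<k} - {c}) = 1" using k ck by simp
    then obtain i where i: "{..<k} - {c} = {i}" by (meson card_1_singletonE)
    then have "{e \<in> edges Q. c \<in> e} = {{c, i}}" using edges by auto
    then have "degree Q c = 1" by (simp add: degree_def)
    then show False using c by (simp add: leaf_def)
  qed
  with that ck k edges assms(1) show ?thesis by auto
qed

definition star_at :: "'a \<Rightarrow> 'a set \<Rightarrow> 'a ugraph" where
  "star_at v L = (insert v L, (\<lambda>u. {v, u}) ` L)"

text \<open>Two distinct edges of a star meet only in its centre, so two leaves suffice to identify
  it.\<close>

lemma star_at_inj:
  assumes "star_at v L = star_at v' L'" "2 \<le> card L" "v \<notin> L" "v' \<notin> L'"
  shows "v = v' \<and> L = L'"
proof -
  have eq: "insert v L = insert v' L'" "(\<lambda>u. {v, u}) ` L = (\<lambda>u. {v', u}) ` L'"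
    using assms(1) by (auto simp: star_at_def)
  have "L \<noteq> {}" using assms(2) by auto
  then obtain a where a: "a \<in> L" by blast
  have "L \<noteq> {a}" using assms(2) by auto
  then obtain b where b: "b \<in> L" "b \<noteq> a" using a by blast
  have "{v, a} \<in> (\<lambda>u. {v', u}) ` L'" "{v, b} \<in> (\<lambda>u. {v', u}) ` L'"
    using a b unfolding eq(2)[symmetric] by auto
  then have "v = v'" using b by (auto simp: doubleton_eq_iff)
  with eq(1) assms(3,4) show ?thesis by auto
qed

lemma decode_star_listing:
  assumes "verts Q = {..<Suc l}" "c \<le> l" "edges Q = (\<lambda>i. {c, i}) ` ({..<Suc l} - {c})" "length ps = l"
  shows "decode Q (star_listing l c ident v ps) = star_at v (ident ` set ps)"
proof -
  let ?xs = "star_listing l c ident v ps"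
  have c: "?xs ! c = v" using assms(2) by (simp add: star_listing_def del: upt_Suc)
  have roles: "{..<Suc l} - {c} = leaf_reg c ` {..<l}"
  proof
    show "{..<Suc l} - {c} \<subseteq> leaf_reg c ` {..<l}"
    proof
      fix r assume r: "r \<in> {..<Suc l} - {c}"
      then have "r = leaf_reg c (if r < c then r else r - 1)" "(if r < c then r else r - 1) < l"
        using assms(2) by (auto simp: leaf_reg_def)
      then show "r \<in> leaf_reg c ` {..<l}" by blast
    qed
  qed (auto simp: leaf_reg_def)
  have "?xs ! leaf_reg c t = ident (ps ! t)" if "t < l" for t
    using that by (auto simp: star_listing_def leaf_reg_def simp del: upt_Suc)
  then have *: "(\<lambda>i. ?xs ! i) ` ({..<Suc l} - {c}) = ident ` set ps"
    unfolding roles using assms(4) by (auto simp: image_image set_conv_nth)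
  have "{..<Suc l} = insert c ({..<Suc l} - {c})" using assms(2) by auto
  then have "(\<lambda>i. ?xs ! i) ` verts Q = insert v (ident ` set ps)"
    using * c assms(1) by (metis image_insert)
  moreover have "(\<lambda>e. (\<lambda>i. ?xs ! i) ` e) ` edges Q = (\<lambda>u. {v, u}) ` ident ` set ps"
    unfolding assms(3) *[symmetric] by (simp add: image_image c)
  ultimately show ?thesis by (simp add: decode_def star_at_def)
qed

text \<open>An isomorphism to \<open>Q\<close> must send the centre to \<open>c\<close> but may
  match the leaves arbitrarily, so an occurrence amounts to a vertex together with \<open>l\<close>
  of its neighbours.\<close>

lemma occurrences_star:
  fixes Q :: "nat ugraph"
  assumes "simple_graph G" "verts Q = {..<Suc l}" "c \<le> l" "edges Q = (\<lambda>i. {c, i}) ` ({..<Suc l} - {c})"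
    "1 \<le> l"
  shows "occurrences Q G = {star_at v L | v L. v \<in> verts G \<and> L \<subseteq> {u. {v, u} \<in> edges G} \<and> card L = l}"
proof (intro subset_antisym subsetI)
  have adjQ: "{i, j} \<in> edges Q \<longleftrightarrow> (i = c \<and> j \<noteq> c \<or> j = c \<and> i \<noteq> c)" if "i \<le> l" "j \<le> l" for i j
    using that unfolding assms(4) by (auto simp: image_iff doubleton_eq_iff less_Suc_eq_le)
  {
    fix H assume "H \<in> occurrences Q G"
    then obtain f where sub: "simple_graph H" "verts H \<subseteq> verts G" "edges H \<subseteq> edges G"
      and bij: "bij_betw f (verts H) {..<Suc l}"
      and iso: "\<And>u v. u \<in> verts H \<Longrightarrow> v \<in> verts H \<Longrightarrow> {u, v} \<in> edges H \<longleftrightarrow> {f u, f v} \<in> edges Q"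
      by (auto simp: occurrences_def subgraph_def isomorphic_def assms(2))
    have fl: "f u \<le> l" if "u \<in> verts H" for u using bij_betwE[OF bij] that by (auto simp: less_Suc_eq_le)
    obtain v where v: "v \<in> verts H" "f v = c"
      using bij_betw_imp_surj_on[OF bij] assms(3) by (metis (no_types) imageE lessThan_iff le_imp_less_Suc)
    have fc: "f u = c \<longleftrightarrow> u = v" if "u \<in> verts H" for u
      using bij v that by (metis bij_betw_inv_into_left)
    define L where "L = verts H - {v}"
    have adjH: "{u, u'} \<in> edges H \<longleftrightarrow> (u = v \<and> u' \<noteq> v \<or> u' = v \<and> u \<noteq> v)"
      if "u \<in> verts H" "u' \<in> verts H" for u u'
      using iso[OF that] adjQ[OF fl fl, OF that] fc that by simp
    have "edges H = (\<lambda>u. {v, u}) ` L"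
    proof (intro subset_antisym subsetI)
      fix e assume e: "e \<in> edges H"
      then have "e \<subseteq> verts H" "card e = 2" using sub(1) by (auto simp: simple_graph_def)
      then obtain x y where xy: "e = {x, y}" "x \<in> verts H" "y \<in> verts H" by (auto simp: card_2_iff)
      then show "e \<in> (\<lambda>u. {v, u}) ` L" using adjH[of x y] e by (auto simp: L_def)
    next
      fix e assume "e \<in> (\<lambda>u. {v, u}) ` L"
      then show "e \<in> edges H" using adjH v by (auto simp: L_def)
    qed
    moreover have "verts H = insert v L" using v by (auto simp: L_def)
    ultimately have H: "H = star_at v L" by (simp add: star_at_def prod_eq_iff)
    have "card (verts H) = Suc l" using bij_betw_same_card[OF bij] by simp
    then have "card L = l" using v sub(1) by (simp add: L_def)
    moreover have "L \<subseteq> {u. {v, u} \<in> edges G}" using sub(3) H by (auto simp: star_at_def)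
    ultimately show "H \<in> {star_at v L | v L. v \<in> verts G \<and> L \<subseteq> {u. {v, u} \<in> edges G} \<and> card L = l}"
      using H v sub(2) by blast
  }
  {
    fix H assume "H \<in> {star_at v L | v L. v \<in> verts G \<and> L \<subseteq> {u. {v, u} \<in> edges G} \<and> card L = l}"
    then obtain v L where H: "H = star_at v L" "v \<in> verts G" "L \<subseteq> {u. {v, u} \<in> edges G}" "card L = l"
      by blast
    have G: "\<And>e. e \<in> edges G \<Longrightarrow> e \<subseteq> verts G \<and> card e = 2" using assms(1) by (auto simp: simple_graph_def)
    have vL: "v \<notin> L" using H(3) G[of "{v, v}"] by auto
    have fin: "finite L" using H(4) assms(5) by (intro card_ge_0_finite) simp
    have "subgraph H G"
      unfolding subgraph_def simple_graph_def H(1)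
      using H(2,3) G fin vL by (auto simp: star_at_def)
    moreover have "isomorphic H Q"
    proof -
      have "card L = card ({..<Suc l} - {c})" using H(4) assms(3) by simp
      then obtain g where g: "bij_betw g L ({..<Suc l} - {c})"
        using fin by (meson finite_Diff finite_lessThan finite_same_card_bij)
      define f where "f = g(v := c)"
      have "bij_betw f L ({..<Suc l} - {c})"
        using g vL by (subst bij_betw_cong[of L f g]) (auto simp: f_def)
      then have "bij_betw f (insert v L) (insert (f v) ({..<Suc l} - {c}))"
        using vL by (intro notIn_Un_bij_betw[of v L f, simplified]) (auto simp: f_def)
      moreover have "insert (f v) ({..<Suc l} - {c}) = {..<Suc l}" using assms(3) by (auto simp: f_def)
      ultimately have f: "bij_betw f (insert v L) {..<Suc l}" by simp
      have fc: "f u = c \<longleftrightarrow> u = v" if "u \<in> insert v L" for u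
        using f that by (metis bij_betw_inv_into_left f_def fun_upd_same insertI1)
      have fl: "f u \<le> l" if "u \<in> insert v L" for u
        using bij_betwE[OF f] that by (auto simp: less_Suc_eq_le)
      have e: "{x, y} \<in> (\<lambda>u. {v, u}) ` L \<longleftrightarrow> {f x, f y} \<in> edges Q" if "x \<in> insert v L" "y \<in> insert v L" for x y
        using adjQ[OF fl fl, OF that] fc that vL by (auto simp: image_iff doubleton_eq_iff)
      show ?thesis unfolding isomorphic_def H(1) star_at_def assms(2) fst_conv snd_conv
        by (intro exI[of _ f] conjI ballI f e)
    qed
    ultimately show "H \<in> occurrences Q G" by (simp add: occurrences_def)
  }
qed

section \<open>Every occurrence is listed exactly once\<close>

lemma distinct_concat_map:
  assumes "distinct xs" "\<And>x. x \<in> set xs \<Longrightarrow> distinct (g x)"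
    "\<And>x y. x \<in> set xs \<Longrightarrow> y \<in> set xs \<Longrightarrow> x \<noteq> y \<Longrightarrow> set (g x) \<inter> set (g y) = {}"
  shows "distinct (concat (map g xs))"
  using assms
proof (induction xs)
  case (Cons a xs)
  have "set (g a) \<inter> set (g x) = {}" if "x \<in> set xs" for x
    using Cons.prems(1) that by (intro Cons.prems(3)) auto
  moreover have "distinct (concat (map g xs))" using Cons.prems by (intro Cons.IH) auto
  ultimately show ?case using Cons.prems(2) by auto
qed simp

text \<open>Pigeonhole for the leaf positions of a star, with \<open>length q = l - 1\<close>: the
  first position \<open>y\<close> satisfies \<open>y + l \<le> e\<close>, and some position is at
  least \<open>y + l - 1\<close>.\<close>

lemma increasing_list_spread:
  assumes "sorted_wrt (<) (y # q)" "set (y # q) \<subseteq> {..<e}"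
  shows "y + Suc (length q) \<le> (e::nat)" "\<exists>z\<in>set (y # q). y + length q \<le> z"
proof -
  have d: "card (set (y # q)) = Suc (length q)" using assms(1) strict_sorted_iff distinct_card by fastforce
  have "set (y # q) \<subseteq> {y..<e}" using assms by (auto simp: subset_iff intro: less_imp_le)
  then have "card (set (y # q)) \<le> card {y..<e}" by (intro card_mono) auto
  then show "y + Suc (length q) \<le> e" using d by simp
  show "\<exists>z\<in>set (y # q). y + length q \<le> z"
  proof (rule ccontr)
    assume "\<not> ?thesis"
    then have "set (y # q) \<subseteq> {y..<y + length q}" using assms(1) by force
    then have "card (set (y # q)) \<le> card {y..<y + length q}" by (intro card_mono) auto
    then show False using d by simp
  qed
qed

text \<open>An increasing list of positions represents a set of leaves uniquely. So the program
  lists the pairs in \<open>S\<close>, each a centre with such a list, without repetition, and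
  \<open>D\<close> maps \<open>S\<close> bijectively onto the occurrences.\<close>

lemma (in query_machine) found_lists_occurrences:
  fixes G Q :: "nat ugraph"
  assumes G: "simple_graph G"
    and Q: "verts Q = {..<Suc l}" "edges Q = (\<lambda>i. {c, i}) ` ({..<Suc l} - {c})"
    and ident: "\<And>v. v \<in> verts G \<Longrightarrow> bij_betw ident {bs v..<be v} {u. {v, u} \<in> edges G}"
    and attr: "\<And>v y. v \<in> verts G \<Longrightarrow> bs v \<le> y \<Longrightarrow> y < be v \<Longrightarrow> attr y = A (ident y)"
    and mono: "\<And>v y z. v \<in> verts G \<Longrightarrow> bs v \<le> y \<Longrightarrow> y \<le> z \<Longrightarrow> z < be v \<Longrightarrow> attr y \<le> attr z"
    and ps: "distinct ps" "sorted_wrt (\<lambda>p q. lo q \<le> lo p) ps"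
      "set ps = {Point v (min (A v) (attr y)) (max (A v) (attr (y + l - 1))) y (be v) | v y.
         v \<in> verts G \<and> bs v \<le> y \<and> y + l \<le> be v}"
    and bnd: "\<And>p y. p \<in> set ps \<Longrightarrow> start p \<le> y \<Longrightarrow> y < bnd p \<longleftrightarrow> y < stop p \<and> attr y \<le> x2"
  shows "lists_occurrences Q (range_subgraph G A x1 x2) (found bnd ps)"
proof -
  define sel where "sel = filter (\<lambda>p. x1 \<le> lo p \<and> hi p \<le> x2) ps"
  define items where "items p = map (\<lambda>q. (centre p, start p # q)) (subseqs_between (l - 1) (Suc (start p)) (bnd p))" for p
  define all where "all = concat (map items sel)"
  define S where "S = {(v, qs). v \<in> verts G \<and> x1 \<le> A v \<and> A v \<le> x2 \<and> length qs = l \<and>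
     sorted_wrt (<) qs \<and> set qs \<subseteq> {bs v..<be v} \<and> (\<forall>y\<in>set qs. x1 \<le> attr y \<and> attr y \<le> x2)}"
  define D where "D = (\<lambda>(v, qs). star_at v (ident ` set qs))"
  have found: "found bnd ps = map (\<lambda>(v, qs). listing v qs) all"
    unfolding found_sorted[OF ps(2)] all_def sel_def items_def stars_def
    by (simp add: map_concat o_def)
  have all_S: "set all = S"
  proof (intro subset_antisym subsetI)
    fix a assume "a \<in> set all"
    then obtain p q where p: "p \<in> set ps" "x1 \<le> lo p" "hi p \<le> x2" and a: "a = (centre p, start p # q)"
      and q: "length q = l - 1" "sorted_wrt (<) q" "set q \<subseteq> {Suc (start p)..<bnd p}"
      by (auto simp: all_def sel_def items_def set_subseqs_between)
    from p(1)[unfolded ps(3)] obtain v y where vy: "p = Point v (min (A v) (attr y)) (max (A v) (attr (y + l - 1))) y (be v)"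
      "v \<in> verts G" "bs v \<le> y" "y + l \<le> be v" by blast
    have "attr y \<le> attr (y + l - 1)" using mono[of v y "y + l - 1"] vy l_ge_2 by simp
    also have "\<dots> \<le> x2" using vy(1) p(3) by simp
    finally have y: "attr y \<le> x2" .
    have "z < be v \<and> attr z \<le> x2 \<and> y \<le> z" if "z \<in> set (y # q)" for z
      using that bnd[OF p(1), of z] q(3) vy y l_ge_2 by auto
    moreover from this have "x1 \<le> attr z" if "z \<in> set (y # q)" for z
      using that mono[of v y z] vy p(2) by fastforce
    ultimately show "a \<in> S" using a vy p q l_ge_2 by (fastforce simp: S_def)
  next
    fix a assume "a \<in> S"
    then obtain v qs where a: "a = (v, qs)" "v \<in> verts G" "x1 \<le> A v" "A v \<le> x2" "length qs = l"
      "sorted_wrt (<) qs" "set qs \<subseteq> {bs v..<be v}" "\<And>y. y \<in> set qs \<Longrightarrow> x1 \<le> attr y \<and> attr y \<le> x2"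
      by (auto simp: S_def)
    obtain y q where q: "qs = y # q" using a(5) l_ge_2 by (cases qs) auto
    have "set (y # q) \<subseteq> {..<be v}" using a(7) q by auto
    note spread = increasing_list_spread[OF a(6)[unfolded q] this]
    have yl: "y + l \<le> be v" using spread(1) a(5) q by simp
    \<comment> \<open>The leaves reach position \<open>y + l - 1\<close> or beyond, and attributes
      do not decrease, so a star inside the range forces \<open>hi p \<le> x2\<close>.\<close>
    obtain z where "z \<in> set qs" "y + length q \<le> z" using spread(2) unfolding q by blast
    then have z: "z \<in> set qs" "y + l - 1 \<le> z" using a(5) q by auto
    have "attr (y + l - 1) \<le> x2"
      using mono[of v "y + l - 1" z] z a(2,7,8) q l_ge_2 by fastforce
    define p where "p = Point v (min (A v) (attr y)) (max (A v) (attr (y + l - 1))) y (be v)"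
    have p: "p \<in> set ps" using a(2,7) q yl unfolding ps(3) p_def by auto
    have "x1 \<le> lo p" "hi p \<le> x2" using a(3,4,8) q \<open>attr (y + l - 1) \<le> x2\<close> by (auto simp: p_def)
    then have ps: "p \<in> set sel" using p by (simp add: sel_def)
    have "set q \<subseteq> {Suc y..<bnd p}"
    proof
      fix x assume x: "x \<in> set q"
      then have "y < x" using a(6) q by simp
      moreover have "x < bnd p" using bnd[OF p, of x] x \<open>y < x\<close> a(7,8) q by (auto simp: p_def)
      ultimately show "x \<in> {Suc y..<bnd p}" by simp
    qed
    then have "a \<in> set (items p)" using a q by (auto simp: items_def set_subseqs_between p_def)
    then show "a \<in> set all" using ps by (auto simp: all_def)
  qed
  \<comment> \<open>Centre and first leaf determine the point, so items of different points are
    disjoint.\<close>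
  have point_eq: "p = p'" if "p \<in> set ps" "p' \<in> set ps" "centre p = centre p'" "start p = start p'" for p p'
    using that unfolding ps(3) by auto
  have dist_all: "distinct all"
    unfolding all_def
  proof (rule distinct_concat_map)
    show "distinct sel" using ps(1) by (simp add: sel_def)
    show "distinct (items p)" for p
      by (auto simp: items_def distinct_map distinct_subseqs_between inj_on_def)
    show "set (items p) \<inter> set (items p') = {}" if "p \<in> set sel" "p' \<in> set sel" "p \<noteq> p'" for p p'
      using that point_eq by (auto simp: items_def sel_def)
  qed
  have dec: "decode Q (listing v qs) = D (v, qs)" if "(v, qs) \<in> S" for v qs
    using that decode_star_listing[OF Q(1) c_le_l Q(2)] by (auto simp: S_def D_def)
  have loop: "{v, v} \<notin> edges G" for v using G by (auto simp: simple_graph_def)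
  have img: "ident ` set qs \<subseteq> {u. {v, u} \<in> edges G} \<and> card (ident ` set qs) = l \<and> v \<notin> ident ` set qs"
    if "(v, qs) \<in> S" for v qs
  proof -
    have v: "v \<in> verts G" "set qs \<subseteq> {bs v..<be v}" "sorted_wrt (<) qs" "length qs = l"
      using that by (auto simp: S_def)
    have b: "inj_on ident (set qs)" "ident ` set qs \<subseteq> {u. {v, u} \<in> edges G}"
      using ident[OF v(1)] v(2) by (auto simp: bij_betw_def inj_on_subset)
    have "card (set qs) = l" using v(3,4) strict_sorted_iff distinct_card by blast
    with b loop[of v] show ?thesis by (auto simp: card_image)
  qed
  have inj: "inj_on D S"
  proof (rule inj_onI)
    fix a b assume ab: "a \<in> S" "b \<in> S" "D a = D b"
    obtain v qs v' qs' where e: "a = (v, qs)" "b = (v', qs')" by (cases a, cases b)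
    have "v = v' \<and> ident ` set qs = ident ` set qs'"
      using ab img[of v qs] img[of v' qs'] l_ge_2 unfolding e by (intro star_at_inj) (auto simp: D_def)
    then have v: "v = v'" "ident ` set qs = ident ` set qs'" by auto
    \<comment> \<open>Within one adjacency list the leaf set determines the positions, and these
      determine the increasing list.\<close>
    have "inj_on ident {bs v..<be v}" using ident[of v] ab e by (auto simp: S_def bij_betw_def)
    then have "set qs = set qs'"
      using v ab e by (intro inj_on_image_eq_iff[THEN iffD1, OF _ _ _ v(2)]) (auto simp: S_def)
    moreover have "sorted_wrt (<) qs" "sorted_wrt (<) qs'" using ab e by (auto simp: S_def)
    ultimately have "qs = qs'" by (metis strict_sorted_equal)
    with v e show "a = b" by simp
  qed
  define G' where "G' = range_subgraph G A x1 x2"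
  have edge: "{v, u} \<in> edges G' \<longleftrightarrow> {v, u} \<in> edges G \<and> x1 \<le> A v \<and> A v \<le> x2 \<and> x1 \<le> A u \<and> A u \<le> x2" for v u
    using G by (auto simp: G'_def range_subgraph_def induced_def simple_graph_def)
  have vert: "v \<in> verts G' \<longleftrightarrow> v \<in> verts G \<and> x1 \<le> A v \<and> A v \<le> x2" for v
    by (auto simp: G'_def range_subgraph_def induced_def)
  have "simple_graph G'"
    using G by (auto simp: G'_def simple_graph_def range_subgraph_def induced_def)
  note occ = occurrences_star[OF this Q(1) c_le_l Q(2)]
  have surj: "D ` S = occurrences Q G'"
  proof (intro subset_antisym subsetI)
    fix H assume "H \<in> D ` S"
    then obtain v qs where H: "H = star_at v (ident ` set qs)" and S: "(v, qs) \<in> S" by (auto simp: D_def)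
    have "{v, ident y} \<in> edges G'" if "y \<in> set qs" for y
    proof -
      have y: "v \<in> verts G" "bs v \<le> y" "y < be v" "x1 \<le> attr y" "attr y \<le> x2" "x1 \<le> A v" "A v \<le> x2"
        using that S by (auto simp: S_def)
      moreover have "{v, ident y} \<in> edges G" using that img[OF S] by auto
      ultimately show ?thesis using attr[OF y(1-3)] by (simp add: edge)
    qed
    then show "H \<in> occurrences Q G'"
      using H S img[OF S] l_ge_2 unfolding occ[OF order_trans[OF one_le_numeral l_ge_2]] by (auto simp: vert S_def)
  next
    fix H assume "H \<in> occurrences Q G'"
    then obtain v L where H: "H = star_at v L" "v \<in> verts G'" "L \<subseteq> {u. {v, u} \<in> edges G'}" "card L = l"
      unfolding occ[OF order_trans[OF one_le_numeral l_ge_2]] by auto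
    have v: "v \<in> verts G" "x1 \<le> A v" "A v \<le> x2" using H(2) vert by auto
    define J where "J = {y \<in> {bs v..<be v}. ident y \<in> L}"
    define qs where "qs = sorted_list_of_set J"
    have fin: "finite J" by (simp add: J_def)
    have "L \<subseteq> {u. {v, u} \<in> edges G}" using H(3) edge by auto
    then have "L \<subseteq> ident ` {bs v..<be v}" using bij_betw_imp_surj_on[OF ident[OF v(1)]] by simp
    then have JL: "ident ` J = L" unfolding J_def by blast
    have "inj_on ident J" using ident[OF v(1)] by (auto simp: bij_betw_def J_def intro: inj_on_subset)
    then have "card J = l" using H(4) JL by (metis card_image)
    then have "length qs = l" "sorted_wrt (<) qs" "set qs = J" using fin by (auto simp: qs_def)
    moreover have "x1 \<le> attr y \<and> attr y \<le> x2" if "y \<in> J" for y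
    proof -
      have "ident y \<in> L" "attr y = A (ident y)" using that attr v(1) by (auto simp: J_def)
      then show ?thesis using H(3) edge by auto
    qed
    ultimately have "(v, qs) \<in> S" "D (v, qs) = H" using v H JL by (auto simp: S_def J_def D_def)
    then show "H \<in> D ` S" by force
  qed
  have map_dec: "map (decode Q) (found bnd ps) = map D all"
    unfolding found using dec all_S by auto
  have "distinct (map D all)" using dist_all inj all_S by (simp add: distinct_map)
  moreover have "\<forall>xs\<in>set (found bnd ps). length xs = card (verts Q)"
    unfolding found by (auto simp: star_listing_def Q(1))
  ultimately show ?thesis
    unfolding lists_occurrences_def map_dec using surj all_S by (auto simp: G'_def)
qed


section \<open>The data structure\<close>

lemma concat_map_block:
  assumes "x \<in> set xs"
  shows "\<exists>b. b + length (f x) \<le> length (concat (map f xs)) \<and>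
    (\<forall>i<length (f x). concat (map f xs) ! (b + i) = f x ! i)"
proof -
  obtain us vs where "xs = us @ x # vs" using assms by (meson split_list)
  then show ?thesis by (intro exI[of _ "length (concat (map f us))"]) (auto simp: nth_append)
qed

text \<open>In a sorted adjacency list the positions with attribute at most \<open>x2\<close> form
  an initial segment; its end will serve as \<open>bnd\<close>.\<close>

lemma prefix_cut:
  assumes "\<And>y z. s \<le> y \<Longrightarrow> y \<le> z \<Longrightarrow> z < e \<Longrightarrow> P z \<Longrightarrow> P y"
  shows "\<exists>f. \<forall>y\<ge>s. y < f \<longleftrightarrow> y < e \<and> P (y::nat)"
proof -
  define f where "f = (LEAST y. s \<le> y \<and> \<not> (y < e \<and> P y))"
  have "s \<le> max s e \<and> \<not> (max s e < e \<and> P (max s e))" by simp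
  then have f: "s \<le> f \<and> \<not> (f < e \<and> P f)" unfolding f_def by (rule LeastI)
  have "y < f \<longleftrightarrow> y < e \<and> P y" if "s \<le> y" for y
  proof
    assume "y < f"
    then show "y < e \<and> P y" using not_less_Least[of y "\<lambda>y. s \<le> y \<and> \<not> (y < e \<and> P y)"] that
      unfolding f_def by blast
  next
    assume y: "y < e \<and> P y"
    show "y < f"
    proof (rule ccontr)
      assume "\<not> y < f"
      then show False using assms[of f y] f y by auto
    qed
  qed
  then show ?thesis by blast
qed

lemma sum_degrees_le:
  fixes G :: "nat ugraph"
  assumes "simple_graph G"
  shows "(\<Sum>v\<in>verts G. card {u. {v, u} \<in> edges G}) \<le> 2 * card (edges G)"
proof -
  have e: "\<And>e. e \<in> edges G \<Longrightarrow> e \<subseteq> verts G \<and> card e = 2" and fin: "finite (verts G)"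
    using assms by (auto simp: simple_graph_def)
  have fine: "finite (edges G)" by (rule finite_subset[of _ "Pow (verts G)"]) (use e fin in auto)
  let ?S = "Sigma (verts G) (\<lambda>v. {u. {v, u} \<in> edges G})"
  have finN: "finite {u. {v, u} \<in> edges G}" for v
    by (rule finite_subset[OF _ fin]) (use e in auto)
  \<comment> \<open>An adjacent pair is recovered from its edge and a Boolean for the direction, so
    every edge is counted at most twice.\<close>
  have "inj_on (\<lambda>(v, u). ({v, u}, v < u)) ?S"
    by (auto simp: inj_on_def doubleton_eq_iff)
  then have "card ?S \<le> card (edges G \<times> (UNIV :: bool set))"
    by (rule card_inj_on_le) (use fine in auto)
  then show ?thesis using fin finN by (simp add: card_cartesian_product)
qed

lemma length_concat_map_le:
  "(\<And>x. x \<in> set xs \<Longrightarrow> length (f x) \<le> length (g x)) \<Longrightarrow>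
    length (concat (map f xs)) \<le> length (concat (map g xs))"
  by (induction xs) (auto intro: add_mono)

text \<open>Of the factors of \<open>(m + 2) ^ (7 + l)\<close>, one provides \<open>m + 2\<close>
  and the others at least \<open>2 ^ 6 * 2 ^ l \<ge> 64 * (l + 1)\<close>, which is enough for all
  addresses.\<close>

lemma word_length_bound:
  assumes "real (7 + l) * log 2 (real m + 2) \<le> real w"
  shows "36 * m + 6 * l + 18 < 2 ^ w"
proof -
  have "real (m + 2) ^ (7 + l) = (real m + 2) powr real (7 + l)"
    by (subst powr_realpow) (auto simp: add.commute)
  also have "\<dots> = (2 powr log 2 (real m + 2)) powr real (7 + l)" by simp
  also have "\<dots> = 2 powr (real (7 + l) * log 2 (real m + 2))"
    by (simp only: powr_powr mult.commute)
  also have "\<dots> \<le> 2 powr real w" using assms by (intro powr_mono) auto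
  also have "\<dots> = real (2 ^ w)" by (simp add: powr_realpow)
  finally have 1: "(m + 2) ^ (7 + l) \<le> 2 ^ w" by (metis of_nat_le_iff of_nat_power)
  have "(2::nat) ^ (6 + l) \<le> (m + 2) ^ (6 + l)" by (intro power_mono) auto
  moreover have "l + 1 \<le> 2 ^ l" by (induction l) auto
  ultimately have "64 * (l + 1) \<le> (m + 2) ^ (6 + l)" by (simp add: power_add)
  then have "(m + 2) * (64 * (l + 1)) \<le> (m + 2) * (m + 2) ^ (6 + l)" by (rule mult_le_mono2)
  also have "\<dots> = (m + 2) ^ (7 + l)" by (simp add: power_Suc[symmetric] del: power_Suc)
  finally have "(m + 2) * (64 * (l + 1)) \<le> 2 ^ w" using 1 by linarith
  moreover have "36 * m + 6 * l + 18 < (m + 2) * (64 * (l + 1))" by (simp add: algebra_simps)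
  ultimately show ?thesis by linarith
qed

lemma range_listing_star:
  fixes G Q :: "nat ugraph"
  assumes l: "2 \<le> l" "c \<le> l"
    and Q: "verts Q = {..<Suc l}" "edges Q = (\<lambda>i. {c, i}) ` ({..<Suc l} - {c})"
    and G: "simple_graph G" "verts G \<subseteq> {..<2 ^ w}"
    and w: "36 * card (edges G) + 6 * l + 18 < 2 ^ w"
    and H: "2 * card (edges G) \<le> 2 ^ H" "real (60 * H + 22 * l + 60) \<le> \<Delta>"
  shows "\<exists>D. word_cells w D \<and> (\<forall>x. Attr x \<in> set D \<longrightarrow> x \<in> A ` verts G) \<and>
    length D \<le> 36 * card (edges G) + 6 \<and>
    (\<forall>x1 x2. \<exists>out. enumerates w (length D) (query_prog l c) \<Delta> (query_config x1 x2 D) out \<and>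
       lists_occurrences Q (range_subgraph G A x1 x2) out)"
proof -
  define m where "m = card (edges G)"
  have e: "\<And>e. e \<in> edges G \<Longrightarrow> e \<subseteq> verts G \<and> card e = 2" and fin: "finite (verts G)"
    using G by (auto simp: simple_graph_def)
  have finN: "finite {u. {v, u} \<in> edges G}" for v
    by (rule finite_subset[OF _ fin]) (use e in auto)
  define nb where "nb v = sort_key A (sorted_list_of_set {u. {v, u} \<in> edges G})" for v
  have nb: "distinct (nb v)" "set (nb v) = {u. {v, u} \<in> edges G}" "sorted (map A (nb v))" for v
    using finN by (auto simp: nb_def)
  have len_nb: "length (nb v) = card {u. {v, u} \<in> edges G}" for v
    using nb(1,2) distinct_card by metis
  define vs where "vs = sorted_list_of_set (verts G)"
  have vs: "set vs = verts G" "distinct vs" using fin by (auto simp: vs_def)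
  define adj where "adj = concat (map nb vs)"
  have "length adj = (\<Sum>v\<in>verts G. card {u. {v, u} \<in> edges G})"
    using vs by (simp add: adj_def length_concat o_def len_nb sum_list_distinct_conv_sum_set)
  then have len_adj: "length adj \<le> 2 * m" using sum_degrees_le[OF G(1)] by (simp add: m_def)
  have "\<forall>v\<in>set vs. \<exists>b. b + length (nb v) \<le> length adj \<and> (\<forall>i<length (nb v). adj ! (b + i) = nb v ! i)"
    unfolding adj_def by (intro ballI concat_map_block)
  from bchoice[OF this] obtain off where off: "\<And>v. v \<in> verts G \<Longrightarrow> off v + length (nb v) \<le> length adj"
    "\<And>v i. v \<in> verts G \<Longrightarrow> i < length (nb v) \<Longrightarrow> adj ! (off v + i) = nb v ! i"
    unfolding vs(1) by blast
  \<comment> \<open>The possible first leaves, with room for \<open>l\<close> leaves from there on.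
    Truncated subtraction makes a list shorter than \<open>l\<close> contribute none.\<close>
  define idx where "idx = concat (map (\<lambda>v. map (Pair v) [0..<length (nb v) + 1 - l]) vs)"
  have set_idx: "set idx = {(v, i). v \<in> verts G \<and> i + l \<le> length (nb v)}"
    using vs(1) l by (fastforce simp: idx_def)
  have dist_idx: "distinct idx"
    unfolding idx_def by (rule distinct_concat_map) (auto simp: vs distinct_map inj_on_def)
  have len_idx: "length idx \<le> length adj"
    unfolding idx_def adj_def by (rule length_concat_map_le) (use l in auto)
  \<comment> \<open>The size of a binary tree with \<open>length idx\<close> leaves, truncated to
    \<open>0\<close> if there are no points. The halting record is number \<open>n\<close>, so the
    adjacency lists start at \<open>Suc n\<close> and never at position \<open>0\<close>.\<close>
  define n where "n = 2 * length idx - 1"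
  define bs where "bs v = Suc n + off v" for v
  define be where "be v = bs v + length (nb v)" for v
  define ident where "ident y = adj ! (y - Suc n)" for y
  define attr where "attr y = A (ident y)" for y
  define mk where "mk v y = Point v (min (A v) (attr y)) (max (A v) (attr (y + l - 1))) y (be v)" for v y
  define ps where "ps = sort_key (\<lambda>p. - lo p) (map (\<lambda>(v, i). mk v (bs v + i)) idx)"
  define nodes where "nodes = (if ps = [] then [] else tree_records 0 (build H ps))"
  define recs where "recs = nodes @ replicate 6 (Word 0) # map (\<lambda>u. Word u # Attr (A u) # replicate 4 (Word 0)) adj"
  have ident_bs: "ident (bs v + i) = nb v ! i" if "v \<in> verts G" "i < length (nb v)" for v i
    using off(2)[OF that] by (simp add: ident_def bs_def)
  have attr_bs: "attr (bs v + i) = map A (nb v) ! i" if "v \<in> verts G" "i < length (nb v)" for v i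
    using ident_bs[OF that] that by (simp add: attr_def)
  have mono: "attr y \<le> attr z" if "v \<in> verts G" "bs v \<le> y" "y \<le> z" "z < be v" for v y z
  proof -
    define i j where "i = y - bs v" and "j = z - bs v"
    then have "y = bs v + i" "z = bs v + j" "i \<le> j" "j < length (nb v)"
      using that by (auto simp: be_def)
    then show ?thesis
      using that(1) attr_bs[of v i] attr_bs[of v j] sorted_nth_mono[OF nb(3)[of v], of i j] by simp
  qed
  have bij: "bij_betw ident {bs v..<be v} {u. {v, u} \<in> edges G}" if v: "v \<in> verts G" for v
  proof (rule bij_betw_imageI)
    have im: "{bs v..<be v} = (+) (bs v) ` {..<length (nb v)}"
      unfolding be_def lessThan_atLeast0 by (simp add: add.commute)
    show "inj_on ident {bs v..<be v}"
      unfolding im inj_on_def using ident_bs[OF v] nb(1)[of v] by (auto simp: nth_eq_iff_index_eq)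
    have "ident ` {bs v..<be v} = (!) (nb v) ` {..<length (nb v)}"
      unfolding im image_image using ident_bs[OF v] by (intro image_cong) auto
    then show "ident ` {bs v..<be v} = {u. {v, u} \<in> edges G}"
      using nb(2)[of v] by (auto simp: set_conv_nth)
  qed
  have ps_set: "set ps = {mk v y | v y. v \<in> verts G \<and> bs v \<le> y \<and> y + l \<le> be v}"
  proof -
    have "set ps = (\<lambda>(v, i). mk v (bs v + i)) ` set idx" by (simp add: ps_def)
    also have "\<dots> = {mk v y | v y. v \<in> verts G \<and> bs v \<le> y \<and> y + l \<le> be v}"
      unfolding set_idx be_def
    proof (intro subset_antisym subsetI; clarify)
      fix v i assume "v \<in> verts G" "i + l \<le> length (nb v)"
      then show "\<exists>v' y. mk v (bs v + i) = mk v' y \<and> v' \<in> verts G \<and> bs v' \<le> y \<and> y + l \<le> bs v' + length (nb v')"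
        by (intro exI[of _ v] exI[of _ "bs v + i"]) auto
    next
      fix v y assume "v \<in> verts G" "bs v \<le> y" "y + l \<le> bs v + length (nb v)"
      then show "mk v y \<in> (\<lambda>(v, i). mk v (bs v + i)) ` {(v, i). v \<in> verts G \<and> i + l \<le> length (nb v)}"
        by (intro image_eqI[of _ _ "(v, y - bs v)"]) auto
    qed
    finally show ?thesis .
  qed
  have ps_dist: "distinct ps"
    unfolding ps_def distinct_sort distinct_map using dist_idx by (auto simp: inj_on_def mk_def)
  have ps_sorted: "sorted_wrt (\<lambda>p q. lo q \<le> lo p) ps"
  proof -
    have "sorted (map (\<lambda>p. - lo p) ps)" by (simp add: ps_def)
    then show ?thesis by (simp add: sorted_map)
  qed
  have len_ps: "length ps = length idx" by (simp add: ps_def)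
  have len_nodes: "length nodes = n"
    using tree_size_leaves[of "build H ps"] build[of ps H] len_ps len_idx len_adj H(1)
    by (auto simp: nodes_def n_def m_def)
  have build: "leaves (build H ps) = ps \<and> tree_height (build H ps) \<le> H" if "ps \<noteq> []"
    using that by (rule build) (use len_ps len_idx len_adj H(1) in \<open>simp add: m_def\<close>)
  have len_recs: "length recs = n + 1 + length adj" by (simp add: recs_def len_nodes)
  \<comment> \<open>There are at most \<open>2 * m\<close> list entries, hence at most that many
    points and at most \<open>4 * m\<close> tree records.\<close>
  have recs_small: "length recs \<le> 6 * m + 1" using len_recs len_idx len_adj by (simp add: n_def)
  have rec_adj: "recs ! y = Word (ident y) # Attr (attr y) # replicate 4 (Word 0)"
    if "v \<in> verts G" "bs v \<le> y" "y < be v" for v y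
  proof -
    have "y - Suc n < length adj" "Suc n \<le> y" using that off(1)[of v] by (auto simp: bs_def be_def)
    then show ?thesis by (simp add: recs_def nth_append len_nodes nth_Cons' ident_def attr_def)
  qed
  have be_le: "be v \<le> length recs" if "v \<in> verts G" for v
    using off(1)[OF that] by (simp add: be_def bs_def len_recs)
  have pt: "\<exists>v y. p = mk v y \<and> v \<in> verts G \<and> bs v \<le> y \<and> y + l \<le> be v" if "p \<in> set ps" for p
    using that unfolding ps_set by blast
  have rec_cells: "length r = 6 \<and> (\<forall>x. Word x \<in> set r \<longrightarrow> x < 2 ^ w) \<and> (\<forall>x. Attr x \<in> set r \<longrightarrow> x \<in> A ` verts G)"
    if rin: "r \<in> set recs" for r
  proof -
    have nbr: "u \<in> verts G" if "u \<in> set adj" for u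
      using that e by (auto simp: adj_def nb)
    have id_v: "ident y \<in> verts G" if "v \<in> verts G" "bs v \<le> y" "y < be v" for v y
    proof -
      have "{v, ident y} \<in> edges G" using bij_betwE[OF bij[OF that(1)]] that by auto
      from e[OF this] show ?thesis by simp
    qed
    consider "r \<in> set nodes" | "r = replicate 6 (Word 0)"
      | u where "u \<in> set adj" "r = Word u # Attr (A u) # replicate 4 (Word 0)"
      using rin by (auto simp: recs_def)
    then show ?thesis
    proof cases
      case 1
      then have ne: "ps \<noteq> []" and r: "r \<in> set (tree_records 0 (build H ps))"
        by (auto simp: nodes_def split: if_splits)
      note cells = tree_records_cells[OF r]
      have "x \<in> A ` verts G" if attr: "Attr x \<in> set r" for x
      proof -
        obtain p where p: "p \<in> set ps" "x = lo p \<or> x = hi p" using cells(2)[OF attr] build[OF ne] by auto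
        obtain v y where v: "p = mk v y" "v \<in> verts G" "bs v \<le> y" "y + l \<le> be v" using pt[OF p(1)] by blast
        have "attr y \<in> A ` verts G" "attr (y + l - 1) \<in> A ` verts G" "A v \<in> A ` verts G"
          using id_v[of v y] id_v[of v "y + l - 1"] v l by (auto simp: attr_def)
        with p(2) v(1) show ?thesis by (auto simp: mk_def min_def max_def)
      qed
      moreover have "x < 2 ^ w" if "Word x \<in> set r" for x
      proof -
        have ts: "tree_size (build H ps) = n" using len_nodes ne by (simp add: nodes_def)
        have big: "6 * length recs < 2 ^ w" using recs_small w by (simp add: m_def)
        from cells(3)[OF that] show ?thesis
        proof (elim disjE bexE)
          assume "x \<le> 6 * (0 + tree_size (build H ps))"
          then show ?thesis using big len_recs ts by simp
        next
          fix p assume "p \<in> set (leaves (build H ps))" and x: "x = centre p"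
          then obtain v y where "p = mk v y" "v \<in> verts G" using pt[of p] build[OF ne] by auto
          then show ?thesis using x G(2) by (auto simp: mk_def)
        next
          fix p assume "p \<in> set (leaves (build H ps))" and x: "x = 6 * start p"
          then obtain v y where "p = mk v y" "v \<in> verts G" "y + l \<le> be v" using pt[of p] build[OF ne] by auto
          then show ?thesis using x be_le[of v] big by (simp add: mk_def)
        next
          fix p assume "p \<in> set (leaves (build H ps))" and x: "x = 6 * stop p"
          then obtain v y where "p = mk v y" "v \<in> verts G" using pt[of p] build[OF ne] by auto
          then show ?thesis using x be_le[of v] big by (simp add: mk_def)
        qed
      qed
      ultimately show ?thesis using cells(1) by blast
    next
      case 3
      then show ?thesis using nbr[of u] G(2) by auto
    qed auto
  qed
  define D where "D = concat recs"
  have "\<exists>out. enumerates w (length D) (query_prog l c) \<Delta> (query_config x1 x2 D) out \<and>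
       lists_occurrences Q (range_subgraph G A x1 x2) out" for x1 x2
  proof -
    interpret query_machine w l c recs x1 x2 \<Delta> ident attr
    proof
      show "6 * (length recs + l + 1) < 2 ^ w" using recs_small w by (simp add: m_def)
    qed (use l rec_cells in auto)
    \<comment> \<open>The cut depends on \<open>x2\<close> and is chosen only in the proof; the
      stored data do not contain it.\<close>
    have "\<forall>p\<in>set ps. \<exists>f. \<forall>y\<ge>start p. y < f \<longleftrightarrow> y < stop p \<and> attr y \<le> x2"
    proof
      fix p assume "p \<in> set ps"
      then obtain v y where v: "p = mk v y" "v \<in> verts G" "bs v \<le> y" "y + l \<le> be v" using pt by blast
      show "\<exists>f. \<forall>y\<ge>start p. y < f \<longleftrightarrow> y < stop p \<and> attr y \<le> x2"
      proof (rule prefix_cut)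
        fix a b assume "start p \<le> a" "a \<le> b" "b < stop p" "attr b \<le> x2"
        then show "attr a \<le> x2" using mono[of v a b] v by (simp add: mk_def)
      qed
    qed
    then obtain bnd where bnd: "\<And>p y. p \<in> set ps \<Longrightarrow> start p \<le> y \<Longrightarrow> y < bnd p \<longleftrightarrow> y < stop p \<and> attr y \<le> x2"
      by metis
    have valid: "valid_point bnd p" if p: "p \<in> set ps" for p
    proof -
      obtain v y where v: "p = mk v y" "v \<in> verts G" "bs v \<le> y" "y + l \<le> be v" using pt[OF p] by blast
      have st: "start p = y" "stop p = be v" "hi p = max (A v) (attr (y + l - 1))" by (auto simp: v mk_def)
      have "0 < y" "y < be v" using v l by (auto simp: bs_def)
      moreover have "recs ! z ! 0 = Word (ident z) \<and> recs ! z ! 1 = Attr (attr z)" if "y \<le> z" "z < be v" for z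
        using rec_adj[OF v(2), of z] that v(3) by simp
      moreover have "y + (l - 1) < bnd p" if "hi p \<le> x2"
        using bnd[OF p, of "y + (l - 1)"] that st v l by simp
      ultimately show ?thesis unfolding valid_point_def st using be_le[OF v(2)] bnd[OF p] st by auto
    qed
    have "enumerates w (length data) prog \<Delta> (query_config x1 x2 data) (found bnd ps)"
    proof (rule query_run)
      show "ps = [] \<and> n = 0 \<or> (\<exists>t. leaves t = ps \<and> placed recs 0 t \<and> tree_size t = n \<and> tree_height t \<le> H)"
      proof (cases "ps = []")
        case True
        then show ?thesis using len_nodes by (simp add: nodes_def)
      next
        case False
        have "placed ([] @ tree_records 0 (build H ps) @ replicate 6 (Word 0) # map (\<lambda>u. Word u # Attr (A u) # replicate 4 (Word 0)) adj) 0 (build H ps)"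
          by (rule placed_tree_records) simp
        then have "placed recs 0 (build H ps)" using False by (simp add: recs_def nodes_def)
        moreover have "tree_size (build H ps) = n" using len_nodes False by (simp add: nodes_def)
        ultimately show ?thesis using build[OF False] by blast
      qed
      show "n < length recs" by (simp add: len_recs)
      show "recs ! n ! 3 = Word 0" by (simp add: recs_def nth_append len_nodes)
    qed (use valid H in auto)
    moreover have "lists_occurrences Q (range_subgraph G A x1 x2) (found bnd ps)"
    proof (rule found_lists_occurrences[where bs = bs and be = be])
      show "set ps = {Point v (min (A v) (attr y)) (max (A v) (attr (y + l - 1))) y (be v) | v y.
         v \<in> verts G \<and> bs v \<le> y \<and> y + l \<le> be v}"
        using ps_set unfolding mk_def .
    qed (use G Q bij mono ps_dist ps_sorted bnd in \<open>auto simp: attr_def\<close>)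
    ultimately show ?thesis unfolding D_def by blast
  qed
  moreover have "word_cells w D" "\<forall>x. Attr x \<in> set D \<longrightarrow> x \<in> A ` verts G"
    using rec_cells by (auto simp: word_cells_def D_def)
  moreover have "length D \<le> 36 * card (edges G) + 6"
  proof -
    have "length D = 6 * length recs"
      using length_concat_uniform[of recs id 6] rec_cells by (simp add: D_def)
    with recs_small show ?thesis by (simp add: m_def)
  qed
  ultimately show ?thesis by blast
qed

theorem theorem7:
  fixes l k :: nat and Q :: "nat ugraph"
  assumes "l \<ge> 1" and "star l Q" and "verts Q = {..<k}"
  shows "\<exists>P c space delay. space \<in> O(\<lambda>m. real m) \<and> delay \<in> soft_O (\<lambda>_. 1) \<and>
           solves_range_listing Q P c space delay"
proof -
  obtain c where c: "c < k" "k = Suc l" "2 \<le> l" "edges Q = (\<lambda>i. {c, i}) ` ({..<k} - {c})"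
    using star_shape[OF assms] .
  define space where "space m = 36 * real m + 6" for m
  \<comment> \<open>This is \<open>60 * H + 22 * l + 60\<close> with the height \<open>H\<close>
    replaced by an upper estimate; the summand 2 keeps the logarithm positive for
    \<open>m = 0\<close>.\<close>
  define delay where "delay m = 60 * (log 2 (2 * real m + 2) + 1) + (22 * real l + 60)" for m
  have "space \<in> O(\<lambda>m. real m)" unfolding space_def by real_asymp
  moreover have "delay \<in> O(\<lambda>n. 1 * ln (real n) ^ 1)" unfolding delay_def by real_asymp
  then have "delay \<in> soft_O (\<lambda>_. 1)" unfolding soft_O_def by blast
  moreover have "solves_range_listing Q (query_prog l c) (real (7 + l)) space delay"
    unfolding solves_range_listing_def
  proof (intro allI impI, elim conjE)
    fix G :: "nat ugraph" and A :: "nat \<Rightarrow> real" and w :: nat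
    assume G: "simple_graph G" "verts G \<subseteq> {..<2 ^ w}"
      and w: "real (7 + l) * log 2 (real (card (edges G)) + 2) \<le> real w"
    define m where "m = card (edges G)"
    define H where "H = nat \<lceil>log 2 (2 * real m + 2)\<rceil>"
    have lg: "0 \<le> log 2 (2 * real m + 2)" by simp
    then have H: "log 2 (2 * real m + 2) \<le> real H" "real H \<le> log 2 (2 * real m + 2) + 1"
      unfolding H_def by linarith+
    have "2 * real m + 2 = 2 powr log 2 (2 * real m + 2)" by simp
    also have "\<dots> \<le> 2 powr real H" using H(1) by (intro powr_mono) auto
    also have "\<dots> = real (2 ^ H)" by (simp add: powr_realpow)
    finally have "real (2 * m) \<le> real (2 ^ H)" by simp
    then have H2: "2 * m \<le> 2 ^ H" by (simp only: of_nat_le_iff)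
    have "real (60 * H + 22 * l + 60) \<le> delay m" using H(2) by (simp add: delay_def)
    from range_listing_star[OF c(3) _ _ _ G word_length_bound[OF w] H2[unfolded m_def] this, of c Q A]
    obtain D where D: "word_cells w D" "\<forall>x. Attr x \<in> set D \<longrightarrow> x \<in> A ` verts G"
      "length D \<le> 36 * m + 6"
      "\<And>x1 x2. \<exists>out. enumerates w (length D) (query_prog l c) (delay m) (query_config x1 x2 D) out \<and>
       lists_occurrences Q (range_subgraph G A x1 x2) out"
      using c assms(3) unfolding m_def by auto
    show "\<exists>D k. word_cells w D \<and> (\<forall>x. Attr x \<in> set D \<longrightarrow> x \<in> A ` verts G) \<and>
        real (length D + k) \<le> space (card (edges G)) \<and>
        (\<forall>x1 x2 W. length W = k \<and> word_cells w W \<longrightarrow>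
          (\<exists>out. enumerates w (length D) (query_prog l c) (delay (card (edges G)))
              (query_config x1 x2 (D @ W)) out \<and>
            lists_occurrences Q (range_subgraph G A x1 x2) out))"
    \<comment> \<open>The program never writes to memory, so the working memory is chosen
      empty.\<close>
    proof (intro exI[of _ D] exI[of _ 0] conjI allI impI)
      show "real (length D + 0) \<le> space (card (edges G))"
        using D(3) unfolding space_def m_def by simp
    qed (use D in \<open>auto simp: m_def\<close>)
  qed
  ultimately show ?thesis by blast
qed

end
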